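(* Let $\sigma=\{\sigma_i\mid i\in I\}$ be a partition of the set of all primes. Let $G$ be a finite group having a normal $\sigma$-Hall subgroup $D$ such that: (i) $G/D$ is a $P\sigma T$-group, and (ii) every $\sigma$-subnormal subgroup of $D$ is normal in $G$. If $G$ is a $\sigma$-full group of Sylow type, then $G$ is a $P\sigma T$-group.
   Context: All groups are finite. For an integer $n$, $\pi(n)$ is the set of primes dividing $n$. $\sigma=\{\sigma_i\mid i\in I\}$ is a partition of the set of all primes, $\sigma(n)=\{\sigma_i\mid \sigma_i\cap\pi(n)\neq\emptyset\}$ and $\sigma(G)=\sigma(|G|)$. A group is $\sigma$-primary if it is a $\sigma_i$-group (all primes dividing its order lie in $\sigma_i$) for some $i$. For a set of primes $\pi$, $G$ is a $D_\pi$-group if $G$ possesses a Hall $\pi$-subgroup $E$ and every $\pi$-subgroup of $G$ is contained in some conjugate of $E$. $G$ is a $\sigma$-full group of Sylow type if every subgroup $E$ of $G$ is a $D_{\sigma_i}$-group for every $\sigma_i\in\sigma(E)$. For $\Pi\subseteq\sigma$ put $\Pi'=\sigma\setminus\Pi$; a natural number $n$ is a $\Pi$-number if $\sigma(n)\subseteq\Pi$. A subgroup $A$ of $G$ is a Hall $\Pi$-subgroup of $G$ if $|A|$ is a $\Pi$-number and $|G:A|$ is a $\Pi'$-number; $A$ is a $\sigma$-Hall subgroup of $G$ if $A$ is a Hall $\Pi$-subgroup of $G$ for some $\Pi\subseteq\sigma$. A subgroup $A$ of $G$ is $\sigma$-subnormal in $G$ if there is a subgroup chain $A=A_0\le A_1\le\cdots\le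 A_n=G$ such that for all $i=1,\dots,n$ either $A_{i-1}\trianglelefteq A_i$ or $A_i/(A_{i-1})_{A_i}$ is $\sigma$-primary, where $(A_{i-1})_{A_i}$ is the core of $A_{i-1}$ in $A_i$ (the largest normal subgroup of $A_i$ contained in $A_{i-1}$). A complete Hall $\sigma$-set of $G$ is a set $\mathcal{H}$ of subgroups of $G$ such that every member $\neq 1$ of $\mathcal{H}$ is a Hall $\sigma_i$-subgroup of $G$ for some $\sigma_i\in\sigma$ and $\mathcal{H}$ contains exactly one Hall $\sigma_i$-subgroup of $G$ for every $\sigma_i\in\sigma(G)$. A subgroup $A$ of $G$ is $\sigma$-permutable in $G$ if $G$ possesses a complete Hall $\sigma$-set and $AH=HA$ for every Hall $\sigma_i$-subgroup $H$ of $G$ and all $i\in I$. $G$ is a $P\sigma T$-group if whenever $K$ is a $\sigma$-permutable subgroup of $H$ and $H$ is a $\sigma$-permutable subgroup of $G$, then $K$ is a $\sigma$-permutable subgroup of $G$. *)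

theory Defs
  imports
    "HOL-Algebra.Coset"
    "HOL-Algebra.Generated_Groups"
    "HOL-Computational_Algebra.Primes"
    "HOL-Library.Disjoint_Sets"
begin

text \<open>
  A subgroup \<open>H\<close> of \<open>G\<close>, regarded as a group in its own right, is \<open>G\<lparr>carrier := H\<rparr>\<close>.
  The partition of the primes is given as the set of its blocks (of type \<open>nat set set\<close>), and
  the set \<open>\<pi>(n)\<close> is \<open>prime_factors n\<close>. All definitions below are meant for finite groups.
\<close>

definition prime_partition :: "nat set set \<Rightarrow> bool" where
  "prime_partition \<sigma> \<longleftrightarrow> partition_on {p. prime p} \<sigma>"

definition sigma_of :: "nat set set \<Rightarrow> nat \<Rightarrow> nat set set" where
  "sigma_of \<sigma> n = {s \<in> \<sigma>. s \<inter> prime_factors n \<noteq> {}}"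

definition subgroup_index :: "('a, 'b) monoid_scheme \<Rightarrow> 'a set \<Rightarrow> nat" where
  "subgroup_index G A = card (rcosets\<^bsub>G\<^esub> A)"

definition pi_group :: "nat set \<Rightarrow> ('a, 'b) monoid_scheme \<Rightarrow> bool" where
  "pi_group \<pi> G \<longleftrightarrow> group G \<and> prime_factors (order G) \<subseteq> \<pi>"

definition sigma_primary :: "nat set set \<Rightarrow> ('a, 'b) monoid_scheme \<Rightarrow> bool" where
  "sigma_primary \<sigma> G \<longleftrightarrow> (\<exists>s\<in>\<sigma>. pi_group s G)"

definition hall_subgroup :: "nat set \<Rightarrow> ('a, 'b) monoid_scheme \<Rightarrow> 'a set \<Rightarrow> bool" where
  "hall_subgroup \<pi> G A \<longleftrightarrow>
     subgroup A G \<and> prime_factors (card A) \<subseteq> \<pi> \<and> prime_factors (subgroup_index G A) \<inter> \<pi> = {}"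

definition D_pi_group :: "nat set \<Rightarrow> ('a, 'b) monoid_scheme \<Rightarrow> bool" where
  "D_pi_group \<pi> G \<longleftrightarrow>
     (\<exists>E. hall_subgroup \<pi> G E \<and>
          (\<forall>U. subgroup U G \<and> pi_group \<pi> (G\<lparr>carrier := U\<rparr>) \<longrightarrow>
               (\<exists>g\<in>carrier G. U \<subseteq> (g <#\<^bsub>G\<^esub> E) #>\<^bsub>G\<^esub> (inv\<^bsub>G\<^esub> g))))"

definition sigma_full_Sylow_type :: "nat set set \<Rightarrow> ('a, 'b) monoid_scheme \<Rightarrow> bool" where
  "sigma_full_Sylow_type \<sigma> G \<longleftrightarrow>
     (\<forall>E. subgroup E G \<longrightarrow> (\<forall>s\<in>sigma_of \<sigma> (card E). D_pi_group s (G\<lparr>carrier := E\<rparr>)))"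

definition Sigma_number :: "nat set set \<Rightarrow> nat set set \<Rightarrow> nat \<Rightarrow> bool" where
  "Sigma_number \<sigma> \<tau> n \<longleftrightarrow> sigma_of \<sigma> n \<subseteq> \<tau>"

definition sigma_Hall_subgroup :: "nat set set \<Rightarrow> ('a, 'b) monoid_scheme \<Rightarrow> 'a set \<Rightarrow> bool" where
  "sigma_Hall_subgroup \<sigma> G A \<longleftrightarrow>
     subgroup A G \<and>
     (\<exists>\<tau>\<subseteq>\<sigma>. Sigma_number \<sigma> \<tau> (card A) \<and> Sigma_number \<sigma> (\<sigma> - \<tau>) (subgroup_index G A))"

definition normal_core :: "('a, 'b) monoid_scheme \<Rightarrow> 'a set \<Rightarrow> 'a set" where
  "normal_core G A = (GREATEST N. N \<lhd> G \<and> N \<subseteq> A)"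

text \<open>The greatest element in the definition above exists whenever \<open>A\<close> is a subgroup.\<close>

lemma normal_core_greatest:
  assumes "group G" and "subgroup A G"
  shows "normal_core G A \<lhd> G" and "normal_core G A \<subseteq> A"
    and "\<And>N. N \<lhd> G \<Longrightarrow> N \<subseteq> A \<Longrightarrow> N \<subseteq> normal_core G A"
proof -
  interpret group G by fact
  define U where "U = \<Union>{N. N \<lhd> G \<and> N \<subseteq> A}"
  have UA: "U \<subseteq> A"
    by (auto simp: U_def)
  have "generate G U \<lhd> G"
  proof (rule normal_generateI)
    show "U \<subseteq> carrier G"
      using UA subgroup.subset[OF assms(2)] by blast
    fix h g assume "h \<in> U" and g: "g \<in> carrier G"
    then obtain N where N: "N \<lhd> G" "N \<subseteq> A" "h \<in> N"
      by (auto simp: U_def)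
    have "g \<otimes>\<^bsub>G\<^esub> h \<otimes>\<^bsub>G\<^esub> inv\<^bsub>G\<^esub> g \<in> N"
      by (rule normal.inv_op_closed2[OF N(1) g N(3)])
    with N(1,2) show "g \<otimes>\<^bsub>G\<^esub> h \<otimes>\<^bsub>G\<^esub> inv\<^bsub>G\<^esub> g \<in> U"
      by (auto simp: U_def)
  qed
  moreover have "generate G U \<subseteq> A"
    by (rule generate_subgroup_incl[OF UA assms(2)])
  moreover have "N \<subseteq> generate G U" if "N \<lhd> G" "N \<subseteq> A" for N
    using that by (auto simp: U_def intro: generate.incl)
  ultimately have P: "generate G U \<lhd> G \<and> generate G U \<subseteq> A"
    and max: "\<And>N. N \<lhd> G \<and> N \<subseteq> A \<Longrightarrow> N \<le> generate G U"
    by auto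
  have "normal_core G A = generate G U"
    unfolding normal_core_def by (rule Greatest_equality[where P = "\<lambda>N. N \<lhd> G \<and> N \<subseteq> A", OF P max])
  with P max show "normal_core G A \<lhd> G" "normal_core G A \<subseteq> A"
    "\<And>N. N \<lhd> G \<Longrightarrow> N \<subseteq> A \<Longrightarrow> N \<subseteq> normal_core G A"
    by auto
qed

definition sigma_subnormal :: "nat set set \<Rightarrow> ('a, 'b) monoid_scheme \<Rightarrow> 'a set \<Rightarrow> bool" where
  "sigma_subnormal \<sigma> G A \<longleftrightarrow>
     (\<exists>n C. C 0 = A \<and> C n = carrier G \<and> (\<forall>i\<le>n. subgroup (C i) G) \<and>
        (\<forall>i<n. C i \<subseteq> C (Suc i) \<and>
           (C i \<lhd> G\<lparr>carrier := C (Suc i)\<rparr> \<or>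
            sigma_primary \<sigma>
              (G\<lparr>carrier := C (Suc i)\<rparr> Mod normal_core (G\<lparr>carrier := C (Suc i)\<rparr>) (C i)))))"

definition complete_Hall_set :: "nat set set \<Rightarrow> ('a, 'b) monoid_scheme \<Rightarrow> 'a set set \<Rightarrow> bool" where
  "complete_Hall_set \<sigma> G \<H> \<longleftrightarrow>
     (\<forall>H\<in>\<H>. subgroup H G) \<and>
     (\<forall>H\<in>\<H>. H \<noteq> {\<one>\<^bsub>G\<^esub>} \<longrightarrow> (\<exists>s\<in>\<sigma>. hall_subgroup s G H)) \<and>
     (\<forall>s\<in>sigma_of \<sigma> (order G). \<exists>!H. H \<in> \<H> \<and> hall_subgroup s G H)"

definition sigma_permutable :: "nat set set \<Rightarrow> ('a, 'b) monoid_scheme \<Rightarrow> 'a set \<Rightarrow> bool" where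
  "sigma_permutable \<sigma> G A \<longleftrightarrow>
     subgroup A G \<and> (\<exists>\<H>. complete_Hall_set \<sigma> G \<H>) \<and>
     (\<forall>s\<in>\<sigma>. \<forall>H. hall_subgroup s G H \<longrightarrow> A <#>\<^bsub>G\<^esub> H = H <#>\<^bsub>G\<^esub> A)"

definition PsigmaT_group :: "nat set set \<Rightarrow> ('a, 'b) monoid_scheme \<Rightarrow> bool" where
  "PsigmaT_group \<sigma> G \<longleftrightarrow>
     (\<forall>H K. sigma_permutable \<sigma> (G\<lparr>carrier := H\<rparr>) K \<and> sigma_permutable \<sigma> G H
        \<longrightarrow> sigma_permutable \<sigma> G K)"

end

theory Submission
  imports Defs
begin

text \<open>
  Let \<open>K\<close> be \<open>\<sigma>\<close>-permutable in \<open>H\<close> and \<open>H\<close> be \<open>\<sigma>\<close>-permutable in \<open>G\<close>; the task is to show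
  \<open>K T = T K\<close> for every Hall subgroup \<open>T\<close> of \<open>G\<close> for a block of \<open>\<sigma>\<close>. Let \<open>\<pi>\<close> be the union of
  the blocks for which \<open>D\<close> is a Hall subgroup, so that \<open>D\<close> is a normal Hall \<open>\<pi>\<close>-subgroup.

  In a \<open>\<sigma>\<close>-full group of Sylow type, \<open>\<sigma>\<close>-permutable subgroups are \<open>\<sigma>\<close>-subnormal
  (lemma \<open>permutable_in_imp_sigma_chain\<close>), in the spirit of Kegel's theorem on subgroups
  permuting with all Sylow subgroups. Hence \<open>K\<close> is \<open>\<sigma>\<close>-subnormal in \<open>G\<close>, and \<open>N = K \<inter> D\<close> is
  \<open>\<sigma>\<close>-subnormal in \<open>D\<close>, so it is normal in \<open>G\<close> by hypothesis (ii). Moreover \<open>|K : N|\<close> is a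
  \<open>\<pi>'\<close>-number. A \<open>\<sigma>\<close>-subnormal \<open>\<pi>'\<close>-subgroup lies in a normal \<open>\<pi>'\<close>-subgroup; relative to \<open>N\<close>
  this gives a normal subgroup \<open>M\<close> of \<open>G\<close> that contains \<open>K\<close> and for which \<open>|M : N|\<close> is a
  \<open>\<pi>'\<close>-number (lemma \<open>sigma_chain_normal_cover\<close>). In particular \<open>M \<inter> D = N\<close>.

  If \<open>T\<close> belongs to a block inside \<open>\<pi>\<close>, then \<open>T \<subseteq> D\<close>, and \<open>[K, T] \<subseteq> M \<inter> D = N \<subseteq> K\<close> makes \<open>K\<close> and
  \<open>T\<close> permute. Otherwise \<open>(M T) \<inter> D = N\<close> for the same arithmetical reason. The images of \<open>K\<close> and
  \<open>T\<close> in \<open>G/D\<close> permute by hypothesis (i), because \<open>\<sigma>\<close>-permutability passes to \<open>G/D\<close>, so that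
  \<open>K D T\<close> is a subgroup. An element \<open>k d t\<close> of \<open>K D T \<inter> M T\<close> has \<open>d \<in> (M T) \<inter> D = N \<subseteq> K\<close>, which
  shows that \<open>K T = K D T \<inter> M T\<close> is a subgroup as well
  (lemma \<open>commute_if_commute_modulo_normal_hall\<close>).

  Everything happens inside one ambient group: subgroups of subgroups are subgroups of \<open>G\<close>, and
  indices are quotients of cardinalities.
\<close>

section \<open>Numbers with prime divisors in a prescribed set\<close>

definition pi_number :: "nat set \<Rightarrow> nat \<Rightarrow> bool" where
  "pi_number \<pi> n \<longleftrightarrow> prime_factors n \<subseteq> \<pi>"

lemma pi_number_one [simp]: "pi_number \<pi> 1" "pi_number \<pi> (Suc 0)"
  by (auto simp: pi_number_def)

lemma pi_number_dvd: "pi_number \<pi> n \<Longrightarrow> m dvd n \<Longrightarrow> n \<noteq> 0 \<Longrightarrow> pi_number \<pi> m"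
  unfolding pi_number_def using dvd_prime_factors[of n m] by auto

lemma pi_number_mono: "pi_number \<pi> n \<Longrightarrow> \<pi> \<subseteq> \<rho> \<Longrightarrow> pi_number \<rho> n"
  by (auto simp: pi_number_def)

lemma pi_number_mult:
  "m \<noteq> 0 \<Longrightarrow> n \<noteq> 0 \<Longrightarrow> pi_number \<pi> (m * n) \<longleftrightarrow> pi_number \<pi> m \<and> pi_number \<pi> n"
  by (auto simp: pi_number_def prime_factors_product)

text \<open>
  Nested subgroups are shown to coincide by applying this to their index, which divides two
  known numbers without common prime divisors.
\<close>

lemma pi_number_disjoint_eq_one:
  assumes "pi_number \<pi> n" "pi_number \<rho> n" "\<pi> \<inter> \<rho> = {}" "n \<noteq> 0"
  shows "n = 1"
proof (rule ccontr)
  assume "n \<noteq> 1"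
  then obtain p where "prime p" "p dvd n" using prime_factor_nat by blast
  with assms show False by (auto simp: pi_number_def prime_factors_dvd)
qed

lemma prime_partition_disjoint:
  "prime_partition \<sigma> \<Longrightarrow> s \<in> \<sigma> \<Longrightarrow> t \<in> \<sigma> \<Longrightarrow> s \<noteq> t \<Longrightarrow> s \<inter> t = {}"
  by (auto simp: prime_partition_def partition_on_def disjoint_def)

lemma prime_partition_cover: "prime_partition \<sigma> \<Longrightarrow> prime p \<Longrightarrow> \<exists>s\<in>\<sigma>. p \<in> s"
  by (auto simp: prime_partition_def partition_on_def)

section \<open>Normality, products and conjugates inside an ambient group\<close>

context group
begin

definition normal_in :: "'a set \<Rightarrow> 'a set \<Rightarrow> bool" where
  "normal_in N E \<longleftrightarrow> subgroup N G \<and> subgroup E G \<and> N \<subseteq> E \<and> (\<forall>e\<in>E. \<forall>x\<in>N. e \<otimes> x \<otimes> inv e \<in> N)"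

abbreviation conjugate :: "'a \<Rightarrow> 'a set \<Rightarrow> 'a set" where
  "conjugate g H \<equiv> (\<lambda>x. g \<otimes> x \<otimes> inv g) ` H"

lemma mult_inv_cancel:
  assumes "g \<in> carrier G" "x \<in> carrier G"
  shows "g \<otimes> (inv g \<otimes> x) = x" "inv g \<otimes> (g \<otimes> x) = x"
  using assms by (simp_all add: m_assoc[symmetric])

lemma subgroup_restrict_iff:
  "subgroup E G \<Longrightarrow> subgroup H (G\<lparr>carrier := E\<rparr>) \<longleftrightarrow> subgroup H G \<and> H \<subseteq> E"
  using incl_subgroup[of E H] subgroup_incl[of H E] subgroup.subset[of H "G\<lparr>carrier := E\<rparr>"] by auto

lemma normal_in_iff: "subgroup E G \<Longrightarrow> normal_in N E \<longleftrightarrow> N \<lhd> G\<lparr>carrier := E\<rparr>"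
  unfolding group.normal_inv_iff[OF subgroup_imp_group] normal_in_def
  by (auto simp: subgroup_restrict_iff m_inv_consistent)

lemma normal_in_carrier_iff: "normal_in N (carrier G) \<longleftrightarrow> N \<lhd> G"
  using normal_in_iff[OF subgroup_self] by simp

lemma mem_set_mult: "x \<in> A <#> B \<longleftrightarrow> (\<exists>a\<in>A. \<exists>b\<in>B. x = a \<otimes> b)"
  by (auto simp: set_mult_def)

lemma set_multI: "a \<in> A \<Longrightarrow> b \<in> B \<Longrightarrow> a \<otimes> b \<in> A <#> B"
  by (auto simp: set_mult_def)

lemma subset_set_mult_left: "subgroup A G \<Longrightarrow> subgroup B G \<Longrightarrow> A \<subseteq> A <#> B"
  by (metis mem_set_mult r_one subgroup.mem_carrier subgroup.one_closed subsetI)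

lemma subset_set_mult_right: "subgroup A G \<Longrightarrow> subgroup B G \<Longrightarrow> B \<subseteq> A <#> B"
  by (metis mem_set_mult l_one subgroup.mem_carrier subgroup.one_closed subsetI)

lemma set_mult_least: "subgroup E G \<Longrightarrow> A \<subseteq> E \<Longrightarrow> B \<subseteq> E \<Longrightarrow> A <#> B \<subseteq> E"
  by (auto simp: mem_set_mult subset_iff intro!: subgroup.m_closed)

text \<open>
  Inversion turns \<open>A B \<subseteq> B A\<close> into the opposite inclusion.
\<close>

lemma set_mult_commute_if_subset:
  assumes "subgroup A G" "subgroup B G" "A <#> B \<subseteq> B <#> A"
  shows "A <#> B = B <#> A"
proof -
  have "b \<otimes> a \<in> A <#> B" if "a \<in> A" "b \<in> B" for a b
  proof -
    have "inv a \<otimes> inv b \<in> B <#> A"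
      using that assms by (meson set_multI subgroup.m_inv_closed subsetD)
    then obtain b' a' where ba: "b' \<in> B" "a' \<in> A" "inv a \<otimes> inv b = b' \<otimes> a'"
      by (auto simp: mem_set_mult)
    have c: "a \<in> carrier G" "b \<in> carrier G" "a' \<in> carrier G" "b' \<in> carrier G"
      using that ba assms by (auto dest: subgroup.mem_carrier)
    have "b \<otimes> a = inv (inv a \<otimes> inv b)" using c by (simp add: inv_mult_group)
    also have "\<dots> = inv a' \<otimes> inv b'" using c ba(3) by (simp add: inv_mult_group)
    finally show ?thesis
      using ba assms by (metis set_multI subgroup.m_inv_closed)
  qed
  then show ?thesis using assms(3) by (force simp: mem_set_mult)
qed

lemma subgroup_set_mult_iff:
  assumes A: "subgroup A G" and B: "subgroup B G"
  shows "subgroup (A <#> B) G \<longleftrightarrow> A <#> B = B <#> A"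
proof
  assume S: "subgroup (A <#> B) G"
  have "B <#> A \<subseteq> A <#> B"
    using subset_set_mult_left[OF A B] subset_set_mult_right[OF A B]
    by (rule set_mult_least[OF S, rotated])
  then show "A <#> B = B <#> A" using set_mult_commute_if_subset[OF B A] by simp
next
  assume c: "A <#> B = B <#> A"
  have sub: "A \<subseteq> carrier G" "B \<subseteq> carrier G" using A B subgroup.subset by auto
  show "subgroup (A <#> B) G"
  proof (rule subgroupI)
    show "A <#> B \<subseteq> carrier G" using sub by (rule setmult_subset_G)
    show "A <#> B \<noteq> {}" using subset_set_mult_left[OF A B] subgroup.one_closed[OF A] by auto
  next
    fix x assume "x \<in> A <#> B"
    then obtain a b where x: "a \<in> A" "b \<in> B" "x = a \<otimes> b" by (auto simp: mem_set_mult)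
    then have "inv x = inv b \<otimes> inv a" using sub by (simp add: inv_mult_group subset_iff)
    then have "inv x \<in> B <#> A" using x A B by (metis set_multI subgroup.m_inv_closed)
    then show "inv x \<in> A <#> B" using c by simp
  next
    fix x y assume x: "x \<in> A <#> B" and y: "y \<in> A <#> B"
    have "(A <#> B) <#> (A <#> B) = A <#> (B <#> A) <#> B"
      using sub by (simp add: set_mult_assoc setmult_subset_G)
    also have "\<dots> = (A <#> A) <#> (B <#> B)"
      unfolding c[symmetric] using sub by (simp add: set_mult_assoc setmult_subset_G)
    also have "\<dots> = A <#> B" using A B by (simp add: subgroup_mult_id)
    finally show "x \<otimes> y \<in> A <#> B" using x y set_multI by blast
  qed
qed

lemma normal_in_subgroups: "normal_in N E \<Longrightarrow> subgroup N G" "normal_in N E \<Longrightarrow> subgroup E G"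
  "normal_in N E \<Longrightarrow> N \<subseteq> E"
  by (auto simp: normal_in_def)

lemma normal_in_conj: "normal_in N E \<Longrightarrow> e \<in> E \<Longrightarrow> x \<in> N \<Longrightarrow> e \<otimes> x \<otimes> inv e \<in> N"
  by (auto simp: normal_in_def)

lemma normal_in_restrict:
  "normal_in N E \<Longrightarrow> subgroup F G \<Longrightarrow> N \<subseteq> F \<Longrightarrow> F \<subseteq> E \<Longrightarrow> normal_in N F"
  by (auto simp: normal_in_def)

lemma normal_in_Int: "normal_in N E \<Longrightarrow> subgroup F G \<Longrightarrow> normal_in (N \<inter> F) (E \<inter> F)"
  by (auto simp: normal_in_def subgroups_Inter_pair intro: subgroup.m_closed subgroup.m_inv_closed)

lemma normal_in_commute:
  assumes N: "normal_in N E" and A: "subgroup A G" "A \<subseteq> E"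
  shows "A <#> N = N <#> A"
proof (rule set_mult_commute_if_subset)
  show "A <#> N \<subseteq> N <#> A"
  proof
    fix x assume "x \<in> A <#> N"
    then obtain a n where x: "a \<in> A" "n \<in> N" "x = a \<otimes> n" by (auto simp: mem_set_mult)
    have c: "a \<in> carrier G" "n \<in> carrier G"
      using x A(1) normal_in_subgroups(1)[OF N] subgroup.mem_carrier by fastforce+
    have "x = (a \<otimes> n \<otimes> inv a) \<otimes> a" using c x(3) by (simp add: m_assoc)
    then show "x \<in> N <#> A" using normal_in_conj[OF N _ x(2), of a] x A by (metis set_multI subsetD)
  qed
qed (use N A in \<open>auto simp: normal_in_def\<close>)

lemma subgroup_set_mult_normal:
  "normal_in N E \<Longrightarrow> subgroup A G \<Longrightarrow> A \<subseteq> E \<Longrightarrow> subgroup (A <#> N) G"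
  using subgroup_set_mult_iff normal_in_commute normal_in_subgroups by metis

lemma conj_hom: "g \<in> carrier G \<Longrightarrow> group_hom G G (\<lambda>x. g \<otimes> x \<otimes> inv g)"
  by unfold_locales (auto simp: hom_def m_assoc mult_inv_cancel)

lemma inj_on_conj: "g \<in> carrier G \<Longrightarrow> H \<subseteq> carrier G \<Longrightarrow> inj_on (\<lambda>x. g \<otimes> x \<otimes> inv g) H"
  by (auto simp: inj_on_def subset_iff)

lemma subgroup_conj: "g \<in> carrier G \<Longrightarrow> subgroup H G \<Longrightarrow> subgroup (conjugate g H) G"
  using group_hom.subgroup_img_is_subgroup[OF conj_hom] .

lemma card_conj: "g \<in> carrier G \<Longrightarrow> subgroup H G \<Longrightarrow> card (conjugate g H) = card H"
  by (simp add: card_image inj_on_conj subgroup.subset)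

lemma conj_conj: "g \<in> carrier G \<Longrightarrow> h \<in> carrier G \<Longrightarrow> H \<subseteq> carrier G \<Longrightarrow> conjugate g (conjugate h H) = conjugate (g \<otimes> h) H"
  unfolding image_image by (rule image_cong) (auto simp: m_assoc inv_mult_group subset_iff)

lemma conj_one: "H \<subseteq> carrier G \<Longrightarrow> conjugate \<one> H = H"
  by (force simp: subset_iff)

lemma conj_set_mult:
  "g \<in> carrier G \<Longrightarrow> A \<subseteq> carrier G \<Longrightarrow> B \<subseteq> carrier G \<Longrightarrow> conjugate g (A <#> B) = conjugate g A <#> conjugate g B"
  using set_mult_hom[of _ G G A B] group_hom.homh[OF conj_hom] by blast

lemma conj_subset: "subgroup E G \<Longrightarrow> g \<in> E \<Longrightarrow> H \<subseteq> E \<Longrightarrow> conjugate g H \<subseteq> E"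
  by (auto intro!: subgroup.m_closed subgroup.m_inv_closed)

lemma conj_eq: "subgroup E G \<Longrightarrow> g \<in> E \<Longrightarrow> conjugate g E = E"
proof -
  assume E: "subgroup E G" "g \<in> E"
  have "x = g \<otimes> (inv g \<otimes> x \<otimes> g) \<otimes> inv g" if "x \<in> E" for x
    using that E by (simp add: subgroup.mem_carrier m_assoc mult_inv_cancel)
  then have "E \<subseteq> conjugate g E"
    using E by (blast intro: subgroup.m_closed subgroup.m_inv_closed)
  then show ?thesis using conj_subset[OF E, of E] by blast
qed

lemma normal_in_conj_eq:
  assumes "normal_in N E" "e \<in> E" shows "conjugate e N = N"
proof -
  have E: "subgroup E G" "subgroup N G" using assms(1) by (auto simp: normal_in_def)
  have "x = e \<otimes> (inv e \<otimes> x \<otimes> inv (inv e)) \<otimes> inv e" if "x \<in> N" for x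
    using that E assms(2) by (simp add: subgroup.mem_carrier m_assoc mult_inv_cancel)
  moreover have "inv e \<otimes> x \<otimes> inv (inv e) \<in> N" if "x \<in> N" for x
    using normal_in_conj[OF assms(1) _ that] E assms(2) by (metis subgroup.m_inv_closed)
  ultimately have "N \<subseteq> conjugate e N" by blast
  then show ?thesis using normal_in_conj[OF assms] by blast
qed

text \<open>
  Used for the families of all Hall subgroups of \<open>E\<close> for given blocks, which are closed under
  conjugation.
\<close>

lemma normal_in_generate:
  assumes E: "subgroup E G" and F: "\<And>X. X \<in> \<F> \<Longrightarrow> X \<subseteq> E"
    and conjugate: "\<And>X e. X \<in> \<F> \<Longrightarrow> e \<in> E \<Longrightarrow> conjugate e X \<in> \<F>"
  shows "normal_in (generate G (\<Union>\<F>)) E"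
proof -
  have sub: "\<Union>\<F> \<subseteq> E" using F by blast
  have "e \<otimes> x \<otimes> inv e \<in> generate G (\<Union>\<F>)" if "x \<in> generate G (\<Union>\<F>)" "e \<in> E" for x e
  proof -
    have e: "e \<in> carrier G" using that E subgroup.mem_carrier by fastforce
    have "(\<lambda>x. e \<otimes> x \<otimes> inv e) ` generate G (\<Union>\<F>) = generate G ((\<lambda>x. e \<otimes> x \<otimes> inv e) ` \<Union>\<F>)"
      using group_hom.generate_img[OF conj_hom[OF e]] sub E subgroup.subset by blast
    also have "\<dots> \<subseteq> generate G (\<Union>\<F>)"
      using conjugate[OF _ that(2)] by (intro mono_generate) blast
    finally show ?thesis using that(1) by blast
  qed
  then show ?thesis
    using sub E by (auto simp: normal_in_def intro!: generate_is_subgroup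
      dest: generate_subgroup_incl[OF sub E, THEN subsetD] subgroup.mem_carrier)
qed

text \<open>
  The set of elements that can be moved past \<open>U\<close> is closed under products, so it is enough to
  move the generators and their inverses.
\<close>

lemma generate_commute:
  assumes X: "X \<subseteq> carrier G" and U: "subgroup U G"
    and c: "\<And>x u. x \<in> X \<Longrightarrow> u \<in> U \<Longrightarrow> x \<otimes> u \<in> U <#> generate G X"
      "\<And>x u. x \<in> X \<Longrightarrow> u \<in> U \<Longrightarrow> inv x \<otimes> u \<in> U <#> generate G X"
  shows "generate G X <#> U = U <#> generate G X"
proof (rule set_mult_commute_if_subset[OF generate_is_subgroup[OF X] U])
  note gX = generate_is_subgroup[OF X]
  have Uc: "u \<in> carrier G" if "u \<in> U" for u using that U subgroup.mem_carrier by fastforce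
  have gc: "y \<in> carrier G" if "y \<in> generate G X" for y using that gX subgroup.mem_carrier by fastforce
  have "\<forall>u\<in>U. y \<otimes> u \<in> U <#> generate G X" if "y \<in> generate G X" for y
    using that
  proof (induction rule: generate.induct)
    case one
    then show ?case using subset_set_mult_left[OF U gX] Uc by auto
  next
    case (eng y z)
    show ?case
    proof
      fix u assume "u \<in> U"
      then obtain u1 z1 where 1: "u1 \<in> U" "z1 \<in> generate G X" "z \<otimes> u = u1 \<otimes> z1"
        using eng.IH(2) by (auto simp: mem_set_mult)
      obtain u2 y1 where 2: "u2 \<in> U" "y1 \<in> generate G X" "y \<otimes> u1 = u2 \<otimes> y1"
        using eng.IH(1) 1(1) by (auto simp: mem_set_mult)
      have cs: "u \<in> carrier G" "u1 \<in> carrier G" "u2 \<in> carrier G" "y \<in> carrier G" "z \<in> carrier G"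
        "y1 \<in> carrier G" "z1 \<in> carrier G"
        using \<open>u \<in> U\<close> 1 2 eng.hyps Uc gc by auto
      have "y \<otimes> z \<otimes> u = y \<otimes> (u1 \<otimes> z1)" using cs 1(3) by (simp add: m_assoc)
      also have "\<dots> = u2 \<otimes> y1 \<otimes> z1" using cs by (simp add: m_assoc[symmetric] 2(3))
      also have "\<dots> = u2 \<otimes> (y1 \<otimes> z1)" using cs by (simp add: m_assoc)
      finally show "y \<otimes> z \<otimes> u \<in> U <#> generate G X"
        using 1(2) 2(1,2) by (simp add: set_multI generate.eng)
    qed
  qed (use c in auto)
  then show "generate G X <#> U \<subseteq> U <#> generate G X"
    by (auto simp: mem_set_mult)
qed

lemma generate_Un_commute:
  assumes A: "subgroup A G" and B: "subgroup B G" and U: "subgroup U G"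
    and "A <#> U = U <#> A" "B <#> U = U <#> B"
  shows "generate G (A \<union> B) <#> U = U <#> generate G (A \<union> B)"
proof (rule generate_commute)
  show sub: "A \<union> B \<subseteq> carrier G" using A B subgroup.subset by blast
  have "U <#> A \<subseteq> U <#> generate G (A \<union> B)" "U <#> B \<subseteq> U <#> generate G (A \<union> B)"
    by (rule mono_set_mult, blast, blast intro: generate.incl)+
  then have "x \<otimes> u \<in> U <#> generate G (A \<union> B)" if "x \<in> A \<union> B" "u \<in> U" for x u
    using that assms(4,5) set_multI[of x _ u U] by blast
  then show "x \<otimes> u \<in> U <#> generate G (A \<union> B)" "inv x \<otimes> u \<in> U <#> generate G (A \<union> B)"
    if "x \<in> A \<union> B" "u \<in> U" for x u
    using that A B by (auto intro: subgroup.m_inv_closed)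
qed (rule U)

lemma normal_in_self: "subgroup E G \<Longrightarrow> normal_in E E"
  by (simp add: normal_in_def subgroup.m_closed subgroup.m_inv_closed)

lemma normal_in_set_mult:
  assumes "normal_in M E" "normal_in N E"
  shows "normal_in (M <#> N) E"
proof -
  have s: "subgroup M G" "subgroup N G" "subgroup E G" "M \<subseteq> E" "N \<subseteq> E"
    using assms by (auto simp: normal_in_def)
  have c: "M \<subseteq> carrier G" "N \<subseteq> carrier G" using s subgroup.subset by blast+
  have "conjugate e (M <#> N) = M <#> N" if "e \<in> E" for e
    using conj_set_mult[OF _ c] that normal_in_conj_eq[OF assms(1) that] normal_in_conj_eq[OF assms(2) that] s
    by (metis subgroup.mem_carrier)
  then have "e \<otimes> x \<otimes> inv e \<in> M <#> N" if "e \<in> E" "x \<in> M <#> N" for e x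
    using that by blast
  then show ?thesis
    using s subgroup_set_mult_normal[OF assms(2)] set_mult_least[of E M N] by (simp add: normal_in_def)
qed

lemma normal_in_conj_subgroup:
  assumes M: "normal_in M C" and C: "normal_in C E" and e: "e \<in> E"
  shows "normal_in (conjugate e M) C"
proof -
  have s: "subgroup M G" "subgroup C G" "subgroup E G" "M \<subseteq> C" "C \<subseteq> E"
    using assms by (auto simp: normal_in_def)
  have ec: "e \<in> carrier G" using s e subgroup.mem_carrier by fastforce
  have MC: "M \<subseteq> carrier G" using s subgroup.subset by blast
  have "conjugate c (conjugate e M) \<subseteq> conjugate e M" if c: "c \<in> C" for c
  proof -
    have cc: "c \<in> carrier G" using s c subgroup.mem_carrier by fastforce
    define d where "d = inv e \<otimes> c \<otimes> inv (inv e)"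
    have dC: "d \<in> C" unfolding d_def
      using normal_in_conj[OF C _ c] e s by (metis subgroup.m_inv_closed)
    have dc: "d \<in> carrier G" using dC s subgroup.mem_carrier by fastforce
    have eq: "c \<otimes> e = e \<otimes> d" unfolding d_def using ec cc by (simp add: m_assoc mult_inv_cancel)
    have "conjugate c (conjugate e M) = conjugate e (conjugate d M)"
      using conj_conj[OF cc ec MC] conj_conj[OF ec dc MC] eq by simp
    also have "conjugate d M = M" by (rule normal_in_conj_eq[OF M dC])
    finally show ?thesis by simp
  qed
  then have "c \<otimes> x \<otimes> inv c \<in> conjugate e M" if "c \<in> C" "x \<in> conjugate e M" for c x
    using that by blast
  moreover have "conjugate e M \<subseteq> C"
    using normal_in_conj[OF C e] s by blast
  ultimately show ?thesis
    using s subgroup_conj[OF ec] by (simp add: normal_in_def)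
qed

lemma normal_in_core:
  assumes E: "subgroup E G" and Q: "subgroup Q G" "Q \<subseteq> E"
  shows "normal_in (\<Inter>g\<in>E. conjugate g Q) E"
proof -
  let ?M = "\<Inter>g\<in>E. conjugate g Q"
  have Ec: "g \<in> carrier G" if "g \<in> E" for g using that E subgroup.mem_carrier by fastforce
  have Qc: "Q \<subseteq> carrier G" using Q subgroup.subset by blast
  have "subgroup ?M G"
    using subgroup.one_closed[OF E] subgroup_conj[OF Ec Q(1)] by (intro subgroups_Inter) auto
  moreover have "?M \<subseteq> E"
    using conj_one[OF Qc] Q(2) subgroup.one_closed[OF E] by blast
  moreover have "e \<otimes> x \<otimes> inv e \<in> conjugate g Q" if e: "e \<in> E" and x: "x \<in> ?M" and g: "g \<in> E" for e x g
  proof -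
    have h: "inv e \<otimes> g \<in> E" using E e g by (simp add: subgroup.m_closed subgroup.m_inv_closed)
    have "e \<otimes> x \<otimes> inv e \<in> conjugate e (conjugate (inv e \<otimes> g) Q)" using x h by blast
    also have "\<dots> = conjugate (e \<otimes> (inv e \<otimes> g)) Q" by (rule conj_conj[OF Ec[OF e] Ec[OF h] Qc])
    also have "e \<otimes> (inv e \<otimes> g) = g" using Ec e g by (simp add: mult_inv_cancel)
    finally show ?thesis .
  qed
  ultimately show ?thesis using E by (simp add: normal_in_def)
qed

end

section \<open>Indices of subgroups of a finite group\<close>

definition rel_index :: "'a set \<Rightarrow> 'a set \<Rightarrow> nat" where
  "rel_index E H = card E div card H"

locale finite_group = group G for G (structure) +
  assumes finite_carrier: "finite (carrier G)"
begin

lemma finite_subgroup: "subgroup H G \<Longrightarrow> finite H"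
  using finite_carrier subgroup.subset finite_subset by blast

lemma card_pos: "subgroup H G \<Longrightarrow> card H > 0"
  using subgroup.finite_imp_card_positive finite_carrier by blast

lemma card_rcosets_mult:
  assumes "subgroup H G" "subgroup E G" "H \<subseteq> E"
  shows "card (rcosets\<^bsub>G\<lparr>carrier := E\<rparr>\<^esub> H) * card H = card E"
proof -
  interpret E: group "G\<lparr>carrier := E\<rparr>" by (rule subgroup_imp_group[OF assms(2)])
  show ?thesis using E.lagrange[of H] assms by (simp add: subgroup_restrict_iff order_def)
qed

lemma card_rcosets:
  assumes "subgroup H G" "subgroup E G" "H \<subseteq> E"
  shows "card (rcosets\<^bsub>G\<lparr>carrier := E\<rparr>\<^esub> H) = rel_index E H"
  using card_rcosets_mult[OF assms] card_pos[OF assms(1)]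
  by (metis nonzero_mult_div_cancel_right neq0_conv rel_index_def)

lemma card_eq_index_mult:
  assumes "subgroup H G" "subgroup E G" "H \<subseteq> E"
  shows "card E = rel_index E H * card H"
  using card_rcosets_mult[OF assms] card_rcosets[OF assms] by simp

lemma rel_index_pos: "subgroup H G \<Longrightarrow> subgroup E G \<Longrightarrow> H \<subseteq> E \<Longrightarrow> rel_index E H > 0"
  using card_eq_index_mult[of H E] card_pos[of E] by (metis gr0I mult_0)

lemma rel_index_mult:
  assumes "subgroup N G" "subgroup M G" "subgroup E G" "N \<subseteq> M" "M \<subseteq> E"
  shows "rel_index E N = rel_index E M * rel_index M N"
proof -
  have "rel_index E N * card N = rel_index E M * rel_index M N * card N"
    using card_eq_index_mult[of N E] card_eq_index_mult[of N M] card_eq_index_mult[of M E] assms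
    by (metis mult.assoc order_trans)
  then show ?thesis using card_pos[OF assms(1)] by simp
qed

lemma pi_number_index_mult:
  assumes "subgroup N G" "subgroup M G" "subgroup E G" "N \<subseteq> M" "M \<subseteq> E"
  shows "pi_number \<pi> (rel_index E N) \<longleftrightarrow> pi_number \<pi> (rel_index E M) \<and> pi_number \<pi> (rel_index M N)"
  unfolding rel_index_mult[OF assms]
  using assms rel_index_pos[of N M] rel_index_pos[of M E] by (simp add: pi_number_mult)

lemma eq_if_index_one:
  assumes "subgroup H G" "subgroup E G" "H \<subseteq> E" "rel_index E H = 1"
  shows "H = E"
  using card_eq_index_mult[OF assms(1-3)] assms finite_subgroup by (simp add: card_subset_eq)

lemma eq_if_index_pi_numbers:
  assumes "subgroup H G" "subgroup E G" "H \<subseteq> E"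
    and "pi_number \<pi> (rel_index E H)" "pi_number \<rho> (rel_index E H)" "\<pi> \<inter> \<rho> = {}"
  shows "H = E"
  using eq_if_index_one[OF assms(1-3)] pi_number_disjoint_eq_one[OF assms(4-6)] rel_index_pos[OF assms(1-3)]
  by simp

lemma pi_number_card_subgroup:
  assumes "subgroup H G" "subgroup E G" "H \<subseteq> E" "pi_number \<pi> (card E)"
  shows "pi_number \<pi> (card H)" "pi_number \<pi> (rel_index E H)"
  using card_eq_index_mult[OF assms(1-3)] card_pos[OF assms(2)] assms(4)
  by (auto intro: pi_number_dvd)

lemma card_set_mult:
  assumes A: "subgroup A G" and B: "subgroup B G"
  shows "card (A <#> B) * card (A \<inter> B) = card A * card B"
proof -
  let ?f = "\<lambda>(a, b). a \<otimes> b"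
  have fin: "finite (A \<times> B)" using A B finite_subgroup by simp
  have Ac: "a \<in> carrier G" if "a \<in> A" for a using that A subgroup.mem_carrier by fastforce
  have Bc: "b \<in> carrier G" if "b \<in> B" for b using that B subgroup.mem_carrier by fastforce
  have im: "?f ` (A \<times> B) = A <#> B" unfolding set_mult_def by force
  have fib: "card {z \<in> A \<times> B. ?f z = x} = card (A \<inter> B)" if x: "x \<in> A <#> B" for x
  proof -
    obtain a b where ab: "a \<in> A" "b \<in> B" "x = a \<otimes> b" using x by (auto simp: mem_set_mult)
    \<comment> \<open>The factorisations of \<open>a \<otimes> b\<close> arise from one of them by moving an element of the
      intersection across.\<close>
    have "bij_betw (\<lambda>c. (a \<otimes> c, inv c \<otimes> b)) (A \<inter> B) {z \<in> A \<times> B. ?f z = x}"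
      unfolding bij_betw_def
    proof (intro conjI equalityI subsetI)
      show "inj_on (\<lambda>c. (a \<otimes> c, inv c \<otimes> b)) (A \<inter> B)"
        using ab Ac by (auto simp: inj_on_def)
    next
      fix z assume "z \<in> (\<lambda>c. (a \<otimes> c, inv c \<otimes> b)) ` (A \<inter> B)"
      then obtain c where c: "c \<in> A" "c \<in> B" and z: "z = (a \<otimes> c, inv c \<otimes> b)" by blast
      have "a \<otimes> c \<otimes> (inv c \<otimes> b) = x" using ab c Ac Bc by (simp add: m_assoc mult_inv_cancel)
      then show "z \<in> {z \<in> A \<times> B. ?f z = x}"
        using ab c z subgroup.m_closed[OF A] subgroup.m_closed[OF B] subgroup.m_inv_closed[OF B] by simp
    next
      fix z assume "z \<in> {z \<in> A \<times> B. ?f z = x}"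
      then obtain a' b' where z: "z = (a', b')" "a' \<in> A" "b' \<in> B" "a' \<otimes> b' = a \<otimes> b"
        using ab(3) by auto
      define c where "c = inv a \<otimes> a'"
      have cs: "a \<in> carrier G" "a' \<in> carrier G" "b \<in> carrier G" "b' \<in> carrier G"
        using ab z Ac Bc by auto
      have "c \<otimes> b' = b" using cs z(4) by (simp add: c_def m_assoc mult_inv_cancel)
      then have "c = b \<otimes> inv b'" using cs by (metis c_def inv_closed inv_solve_right m_closed)
      then have "c \<in> B" using ab z B by (simp add: subgroup.m_closed subgroup.m_inv_closed)
      moreover have "c \<in> A" using ab z A by (simp add: c_def subgroup.m_closed subgroup.m_inv_closed)
      moreover have "z = (a \<otimes> c, inv c \<otimes> b)"
        using cs z \<open>c \<otimes> b' = b\<close> by (auto simp: c_def mult_inv_cancel)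
      ultimately show "z \<in> (\<lambda>c. (a \<otimes> c, inv c \<otimes> b)) ` (A \<inter> B)" by blast
    qed
    from bij_betw_same_card[OF this] show ?thesis by (rule sym)
  qed
  have "card A * card B = (\<Sum>z\<in>A \<times> B. 1)" by (simp add: card_cartesian_product)
  also have "\<dots> = (\<Sum>x\<in>?f ` (A \<times> B). \<Sum>z\<in>{z \<in> A \<times> B. ?f z = x}. 1)"
    by (rule sum.image_gen[OF fin])
  also have "\<dots> = (\<Sum>x\<in>A <#> B. card (A \<inter> B))"
    unfolding im using fib by (intro sum.cong) auto
  finally show ?thesis by simp
qed

lemma rel_index_set_mult:
  assumes "subgroup A G" "subgroup B G"
  shows "rel_index (A <#> B) B = rel_index A (A \<inter> B)"
proof -
  have "card (A <#> B) * card (A \<inter> B) = rel_index A (A \<inter> B) * card B * card (A \<inter> B)"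
    using card_set_mult[OF assms] card_eq_index_mult[of "A \<inter> B" A] subgroups_Inter_pair[OF assms] assms
    by (simp add: mult.commute mult.left_commute)
  then have "card (A <#> B) = rel_index A (A \<inter> B) * card B"
    using card_pos[OF subgroups_Inter_pair[OF assms]] by simp
  then show ?thesis using card_pos[OF assms(2)] by (simp add: rel_index_def)
qed

lemma rel_index_Int_dvd:
  assumes C: "normal_in C E" and A: "subgroup A G" "A \<subseteq> E"
  shows "rel_index A (A \<inter> C) dvd rel_index E C"
proof -
  have s: "subgroup C G" "subgroup E G" "C \<subseteq> E" using C by (auto simp: normal_in_def)
  have AC: "subgroup (A <#> C) G" by (rule subgroup_set_mult_normal[OF C A])
  have "rel_index E C = rel_index E (A <#> C) * rel_index (A <#> C) C"
    using AC s A by (intro rel_index_mult subset_set_mult_right set_mult_least)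
  then show ?thesis using rel_index_set_mult[OF A(1) s(1)] by simp
qed

lemma pi_number_index_Int:
  assumes C: "normal_in C E" and A: "subgroup A G" "A \<subseteq> E" and "pi_number \<pi> (rel_index E C)"
  shows "pi_number \<pi> (rel_index A (A \<inter> C))"
  using pi_number_dvd[OF assms(4) rel_index_Int_dvd[OF C A]] rel_index_pos[of C E] C
  by (simp add: normal_in_def)

lemma rel_index_conj:
  "g \<in> carrier G \<Longrightarrow> subgroup H G \<Longrightarrow> rel_index (conjugate g H) N = rel_index H N"
  "g \<in> carrier G \<Longrightarrow> subgroup H G \<Longrightarrow> rel_index E (conjugate g H) = rel_index E H"
  by (simp_all add: rel_index_def card_conj)

lemma ex_maximal_subgroup:
  assumes "subgroup A G" "P A"
  obtains X where "subgroup X G" "P X" "A \<subseteq> X" "\<And>Y. subgroup Y G \<Longrightarrow> P Y \<Longrightarrow> X \<subseteq> Y \<Longrightarrow> Y = X"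
proof -
  have "finite {X. subgroup X G \<and> P X}"
    using finite_subset[of "{X. subgroup X G \<and> P X}" "Pow (carrier G)"] finite_carrier subgroup.subset by auto
  from finite_has_maximal2[OF this, of A] obtain X
    where "subgroup X G" "P X" "A \<subseteq> X" "\<forall>Y\<in>{X. subgroup X G \<and> P X}. X \<subseteq> Y \<longrightarrow> X = Y"
    using assms by auto
  then show thesis using that[of X] by blast
qed

text \<open>
  The subgroup \<open>R\<close> plays the role of the largest normal \<open>\<rho>\<close>-subgroup of \<open>C\<close> modulo \<open>N\<close>, which is
  characteristic: the product of a maximal \<open>R\<close> with a conjugate \<open>R\<^sup>e\<close>, \<open>e \<in> E\<close>, is again such a
  subgroup, so maximality gives \<open>R\<^sup>e \<subseteq> R\<close>.
\<close>

lemma normal_in_extend: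
  assumes N: "normal_in N E" and C: "normal_in C E" and M: "normal_in M C" and "N \<subseteq> M"
    and "pi_number \<rho> (rel_index M N)"
  obtains R where "normal_in R E" "M \<subseteq> R" "R \<subseteq> C" "pi_number \<rho> (rel_index R N)"
proof -
  have s: "subgroup M G" "subgroup C G" "subgroup E G" "M \<subseteq> C" "C \<subseteq> E"
    using C M by (auto simp: normal_in_def)
  have sN: "subgroup N G" using N by (simp add: normal_in_def)
  let ?P = "\<lambda>R. normal_in R C \<and> N \<subseteq> R \<and> pi_number \<rho> (rel_index R N)"
  obtain R where R: "subgroup R G" "?P R" "M \<subseteq> R"
    and max: "\<And>Y. subgroup Y G \<Longrightarrow> ?P Y \<Longrightarrow> R \<subseteq> Y \<Longrightarrow> Y = R"
    using ex_maximal_subgroup[of M ?P] s(1) assms by blast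
  have "conjugate e R \<subseteq> R" if e: "e \<in> E" for e
  proof -
    have ec: "e \<in> carrier G" using e s subgroup.mem_carrier by fastforce
    have Re: "normal_in (conjugate e R) C" using normal_in_conj_subgroup[OF _ C e] R(2) by blast
    define Y where "Y = conjugate e R <#> R"
    have sRe: "subgroup (conjugate e R) G" using Re by (simp add: normal_in_def)
    have Y: "normal_in Y C" unfolding Y_def using Re R(2) by (intro normal_in_set_mult) auto
    then have sY: "subgroup Y G" by (simp add: normal_in_def)
    have RY: "R \<subseteq> Y" "conjugate e R \<subseteq> Y"
      unfolding Y_def using subset_set_mult_right[OF sRe R(1)] subset_set_mult_left[OF sRe R(1)] by auto
    have "rel_index Y R = rel_index (conjugate e R) (conjugate e R \<inter> R)"
      unfolding Y_def by (rule rel_index_set_mult[OF sRe R(1)])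
    moreover have "pi_number \<rho> (rel_index (conjugate e R) (conjugate e R \<inter> R))"
    proof -
      have "N \<subseteq> conjugate e R" using normal_in_conj_eq[OF N e] R(2) by blast
      moreover have "pi_number \<rho> (rel_index (conjugate e R) N)" using rel_index_conj(1)[OF ec R(1)] R(2) by simp
      ultimately show ?thesis
        using pi_number_index_mult[of N "conjugate e R \<inter> R" "conjugate e R"] s(1,4) sN R(1,2) sRe subgroups_Inter_pair
        by simp
    qed
    ultimately have "pi_number \<rho> (rel_index Y N)"
      using pi_number_index_mult[OF sN R(1) sY] R(2) RY by simp
    then have "Y = R" using max[OF sY] Y R(2) RY by blast
    then show ?thesis using RY by simp
  qed
  then have "normal_in R E" using R s by (auto simp: normal_in_def)
  then show thesis using that R by (auto simp: normal_in_def)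
qed

end

section \<open>Sigma-subnormal chains and Hall subgroups\<close>

text \<open>
  One link of a chain that witnesses \<open>\<sigma>\<close>-subnormality. The core of \<open>A\<close> in \<open>E\<close> is replaced by an
  arbitrary normal subgroup \<open>C\<close> of \<open>E\<close> below \<open>A\<close>: if some such \<open>C\<close> has an \<open>s\<close>-number as index, then
  so has the core, and a free choice of \<open>C\<close> is easier to restrict to subgroups.
\<close>

definition sigma_step :: "nat set set \<Rightarrow> ('a, 'b) monoid_scheme \<Rightarrow> 'a set \<Rightarrow> 'a set \<Rightarrow> bool" where
  "sigma_step \<sigma> G A E \<longleftrightarrow> subgroup A G \<and> subgroup E G \<and> A \<subseteq> E \<and>
     (group.normal_in G A E \<or>
      (\<exists>s\<in>\<sigma>. \<exists>C. group.normal_in G C E \<and> C \<subseteq> A \<and> pi_number s (rel_index E C)))"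

context group
begin

definition hall_in :: "nat set \<Rightarrow> 'a set \<Rightarrow> 'a set \<Rightarrow> bool" where
  "hall_in s E H \<longleftrightarrow> subgroup H G \<and> H \<subseteq> E \<and> pi_number s (card H) \<and> pi_number (- s) (rel_index E H)"

definition permutable_in :: "nat set set \<Rightarrow> 'a set \<Rightarrow> 'a set \<Rightarrow> bool" where
  "permutable_in \<sigma> E A \<longleftrightarrow> subgroup E G \<and> subgroup A G \<and> A \<subseteq> E \<and>
     (\<forall>s\<in>\<sigma>. \<forall>T. hall_in s E T \<longrightarrow> A <#> T = T <#> A)"

lemma sigma_chain_Int:
  assumes "finite_group G" "(sigma_step \<sigma> G)\<^sup>*\<^sup>* A E" "subgroup D G"
  shows "(sigma_step \<sigma> G)\<^sup>*\<^sup>* (A \<inter> D) (E \<inter> D)"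
  using assms(2)
proof (induction rule: rtranclp_induct)
  case (step B E)
  interpret finite_group G by (rule assms(1))
  note st = step.hyps(2)[unfolded sigma_step_def]
  have sub: "subgroup (B \<inter> D) G" "subgroup (E \<inter> D) G"
    using st assms(3) by (auto intro: subgroups_Inter_pair)
  from st consider (norm) "normal_in B E"
    | (prim) s C where "s \<in> \<sigma>" "normal_in C E" "C \<subseteq> B" "pi_number s (rel_index E C)"
    by blast
  then have "sigma_step \<sigma> G (B \<inter> D) (E \<inter> D)"
  proof cases
    case norm
    then show ?thesis using normal_in_Int[OF norm assms(3)] st sub by (auto simp: sigma_step_def)
  next
    case prim
    have "pi_number s (rel_index (E \<inter> D) (E \<inter> D \<inter> C))"
      by (rule pi_number_index_Int[OF prim(2) sub(2) _ prim(4)]) simp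
    moreover have "E \<inter> D \<inter> C = C \<inter> D" using prim(3) st by blast
    ultimately have "pi_number s (rel_index (E \<inter> D) (C \<inter> D))" by simp
    moreover have "normal_in (C \<inter> D) (E \<inter> D)" by (rule normal_in_Int[OF prim(2) assms(3)])
    moreover have "C \<inter> D \<subseteq> B \<inter> D" using prim(3) by blast
    ultimately show ?thesis using prim(1) st sub unfolding sigma_step_def by blast
  qed
  with step.IH show ?case by (rule rtranclp.rtrancl_into_rtrancl)
qed simp

end

context finite_group
begin

lemma hall_in_iff:
  assumes E: "subgroup E G"
  shows "hall_subgroup s (G\<lparr>carrier := E\<rparr>) H \<longleftrightarrow> hall_in s E H"
proof -
  have "subgroup_index (G\<lparr>carrier := E\<rparr>) H = rel_index E H" if "subgroup H G" "H \<subseteq> E"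
    using card_rcosets[OF that(1) E that(2)] by (simp add: subgroup_index_def)
  then show ?thesis
    using E by (auto simp: hall_subgroup_def hall_in_def subgroup_restrict_iff pi_number_def)
qed

lemma hall_in_conj:
  assumes "hall_in s E H" "subgroup E G" "e \<in> E"
  shows "hall_in s E (conjugate e H)"
proof -
  have e: "e \<in> carrier G" using assms(2,3) subgroup.mem_carrier by fastforce
  show ?thesis
    using assms conj_subset[OF assms(2,3)] e
    by (simp add: hall_in_def subgroup_conj card_conj rel_index_conj)
qed

text \<open>
  The index of \<open>T\<close> in \<open>U\<close> divides both \<open>|U|\<close> and \<open>|E : T|\<close>.
\<close>

lemma hall_in_eq:
  assumes "hall_in s E T" "subgroup U G" "T \<subseteq> U" "U \<subseteq> E" "subgroup E G" "pi_number s (card U)"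
  shows "U = T"
proof -
  have T: "subgroup T G" "pi_number (- s) (rel_index E T)" using assms(1) by (auto simp: hall_in_def)
  have "pi_number (- s) (rel_index U T)"
    using pi_number_index_mult[OF T(1) assms(2,5,3,4)] T(2) by blast
  then show ?thesis
    using eq_if_index_pi_numbers[OF T(1) assms(2,3), of s "- s"] pi_number_card_subgroup(2)[OF T(1) assms(2,3,6)]
    by simp
qed

text \<open>
  Each subgroup \<open>N\<close> that justifies a primary link lies in the core \<open>K\<close>, so \<open>|E : K|\<close> divides
  \<open>|E : N|\<close>.
\<close>

lemma sigma_chain_imp_subnormal:
  assumes "(sigma_step \<sigma> G)\<^sup>*\<^sup>* A D" "subgroup D G"
  shows "sigma_subnormal \<sigma> (G\<lparr>carrier := D\<rparr>) A"
proof -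
  obtain n C where C: "C 0 = A" "C n = D" and step: "\<And>i. i < n \<Longrightarrow> sigma_step \<sigma> G (C i) (C (Suc i))"
    using rtranclp_imp_relpowp[OF assms(1)] unfolding relpowp_fun_conv by blast
  have sub: "subgroup (C i) G \<and> C i \<subseteq> D" if "i \<le> n" for i
    using that
  proof (induction rule: inc_induct)
    case base
    then show ?case using C(2) assms(2) by simp
  next
    case (step i)
    then show ?case using \<open>\<And>i. i < n \<Longrightarrow> sigma_step \<sigma> G (C i) (C (Suc i))\<close>[of i]
      by (auto simp: sigma_step_def)
  qed
  have "C i \<lhd> G\<lparr>carrier := E\<rparr> \<or>
      sigma_primary \<sigma> (G\<lparr>carrier := E\<rparr> Mod normal_core (G\<lparr>carrier := E\<rparr>) (C i))"
    if i: "i < n" and E_def: "E = C (Suc i)" for i E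
  proof -
    have st: "sigma_step \<sigma> G (C i) E" using step[OF i] E_def by simp
    have sE: "subgroup E G" "subgroup (C i) G" "C i \<subseteq> E" using st by (auto simp: sigma_step_def)
    interpret E: group "G\<lparr>carrier := E\<rparr>" by (rule subgroup_imp_group[OF sE(1)])
    from st consider (norm) "normal_in (C i) E"
      | (prim) s N where "s \<in> \<sigma>" "normal_in N E" "N \<subseteq> C i" "pi_number s (rel_index E N)"
      unfolding sigma_step_def by blast
    then show ?thesis
    proof cases
      case norm
      then show ?thesis using normal_in_iff[OF sE(1)] by blast
    next
      case prim
      define K where "K = normal_core (G\<lparr>carrier := E\<rparr>) (C i)"
      note core = normal_core_greatest[OF E.is_group, of "C i", folded K_def]
      have sC: "subgroup (C i) (G\<lparr>carrier := E\<rparr>)" using sE by (simp add: subgroup_restrict_iff)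
      have K: "K \<lhd> G\<lparr>carrier := E\<rparr>" "N \<subseteq> K"
        using core(1)[OF sC] core(3)[OF sC _ prim(3)] prim(2) normal_in_iff[OF sE(1)] by auto
      then have sK: "subgroup K G" "K \<subseteq> E"
        using normal_in_iff[OF sE(1), of K] by (auto simp: normal_in_def)
      have "pi_number s (rel_index E K)"
        using pi_number_index_mult[of N K E s] prim(2,4) sK K(2) by (auto simp: normal_in_def)
      moreover have "order (G\<lparr>carrier := E\<rparr> Mod K) = rel_index E K"
        using card_rcosets[OF sK(1) sE(1) sK(2)] by (simp add: order_def FactGroup_def)
      moreover have "group (G\<lparr>carrier := E\<rparr> Mod K)" by (rule normal.factorgroup_is_group[OF K(1)])
      ultimately have "sigma_primary \<sigma> (G\<lparr>carrier := E\<rparr> Mod K)"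
        using prim(1) by (auto simp: sigma_primary_def pi_group_def pi_number_def)
      then show ?thesis by (simp add: K_def)
    qed
  qed
  moreover have "C i \<subseteq> C (Suc i)" if "i < n" for i
    using step[OF that] by (simp add: sigma_step_def)
  ultimately show ?thesis
    unfolding sigma_subnormal_def using C sub assms(2)
    by (intro exI[of _ n] exI[of _ C]) (simp add: subgroup_restrict_iff)
qed

end

locale sigma_full_group = finite_group G for G (structure) +
  fixes \<sigma> :: "nat set set"
  assumes partition: "prime_partition \<sigma>" and full: "sigma_full_Sylow_type \<sigma> G"
begin

text \<open>
  The defining property of \<open>\<sigma>\<close>-full groups speaks only of blocks that divide \<open>|E|\<close>; for the other
  blocks the trivial subgroup is a Hall subgroup, and \<open>U\<close> itself is trivial.
\<close>

lemma ex_hall_containing: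
  assumes s: "s \<in> \<sigma>" and E: "subgroup E G" and U: "subgroup U G" "U \<subseteq> E" "pi_number s (card U)"
  obtains T where "hall_in s E T" "U \<subseteq> T"
proof (cases "s \<in> sigma_of \<sigma> (card E)")
  case True
  then have "D_pi_group s (G\<lparr>carrier := E\<rparr>)"
    using full E by (auto simp: sigma_full_Sylow_type_def)
  moreover have "subgroup U (G\<lparr>carrier := E\<rparr>)" "pi_group s (G\<lparr>carrier := E\<rparr>\<lparr>carrier := U\<rparr>)"
    using U E subgroup_imp_group[OF U(1)]
    by (simp_all add: subgroup_restrict_iff pi_group_def pi_number_def order_def)
  ultimately obtain T g where T: "hall_subgroup s (G\<lparr>carrier := E\<rparr>) T" and g: "g \<in> E"
    and sub: "U \<subseteq> (g <#\<^bsub>G\<lparr>carrier := E\<rparr>\<^esub> T) #>\<^bsub>G\<lparr>carrier := E\<rparr>\<^esub> (inv\<^bsub>G\<lparr>carrier := E\<rparr>\<^esub> g)"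
    unfolding D_pi_group_def by (metis partial_object.select_convs(1) partial_object.surjective partial_object.update_convs(1))
  have "(g <# T) #> inv g = conjugate g T"
    by (auto simp: l_coset_def r_coset_def)
  then have "U \<subseteq> conjugate g T"
    using sub m_inv_consistent[OF E g] by simp
  moreover have "hall_in s E (conjugate g T)"
    using hall_in_conj[OF _ E g] T hall_in_iff[OF E] by blast
  ultimately show thesis using that by blast
next
  case False
  then have "pi_number (- s) (card E)" using s by (auto simp: sigma_of_def pi_number_def)
  then have "hall_in s E U"
    using U pi_number_card_subgroup(2)[OF U(1) E U(2)] by (simp add: hall_in_def)
  then show thesis using that by blast
qed

lemma ex_hall: "s \<in> \<sigma> \<Longrightarrow> subgroup E G \<Longrightarrow> \<exists>T. hall_in s E T"
  using ex_hall_containing[of s E "{\<one>}"] triv_subgroup subgroup.one_closed[of E G]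
  by (metis card.empty card_insert_if empty_iff empty_subsetI finite.emptyI insert_subset pi_number_one(2))

section \<open>Sigma-permutable subgroups are sigma-subnormal\<close>

text \<open>
  A Hall subgroup \<open>T\<close> of \<open>F\<close> has the form \<open>S \<inter> F\<close> with \<open>S\<close> a Hall subgroup of \<open>E\<close>, and the modular
  law gives \<open>A T = (A S) \<inter> F\<close>, an intersection of two subgroups.
\<close>

lemma permutable_in_subgroup:
  assumes A: "permutable_in \<sigma> E A" and F: "subgroup F G" "A \<subseteq> F" "F \<subseteq> E"
  shows "permutable_in \<sigma> F A"
proof -
  have sA: "subgroup A G" "subgroup E G" using A by (auto simp: permutable_in_def)
  have "A <#> T = T <#> A" if s: "s \<in> \<sigma>" and T: "hall_in s F T" for s T
  proof -
    have sT: "subgroup T G" "T \<subseteq> F" "pi_number s (card T)" using T by (auto simp: hall_in_def)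
    obtain S where S: "hall_in s E S" "T \<subseteq> S"
      using ex_hall_containing[OF s sA(2) sT(1) _ sT(3)] sT(2) F(3) by blast
    have sS: "subgroup S G" using S by (simp add: hall_in_def)
    have "S \<inter> F = T"
      using S sT F T subgroups_Inter_pair[OF sS F(1)]
      by (intro hall_in_eq[OF T _ _ _ F(1)]) (auto simp: hall_in_def intro: pi_number_card_subgroup(1)[OF _ sS])
    moreover have "A <#> T = (A <#> S) \<inter> F"
    proof
      show "A <#> T \<subseteq> (A <#> S) \<inter> F"
        using set_mult_least[OF F(1,2) sT(2)] mono_set_mult[of A A T S] S(2) by blast
      show "(A <#> S) \<inter> F \<subseteq> A <#> T"
      proof
        fix y assume "y \<in> (A <#> S) \<inter> F"
        then obtain a x where y: "a \<in> A" "x \<in> S" "y = a \<otimes> x" "y \<in> F" by (auto simp: mem_set_mult)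
        have c: "a \<in> carrier G" "x \<in> carrier G" using y sA sS subgroup.mem_carrier by fastforce+
        have "x = inv a \<otimes> y" using c y(3) by (simp add: mult_inv_cancel)
        then have "x \<in> F" using y F by (metis subgroup.m_closed subgroup.m_inv_closed subsetD)
        then show "y \<in> A <#> T" using y \<open>S \<inter> F = T\<close> by (auto intro: set_multI)
      qed
    qed
    moreover have "subgroup (A <#> S) G"
      using A S(1) s subgroup_set_mult_iff[OF sA(1) sS] by (simp add: permutable_in_def)
    ultimately have "subgroup (A <#> T) G" using subgroups_Inter_pair F(1) by simp
    then show ?thesis using subgroup_set_mult_iff[OF sA(1) sT(1)] by simp
  qed
  then show ?thesis using sA F by (simp add: permutable_in_def)
qed

lemma permutable_in_set_mult_normal:
  assumes A: "permutable_in \<sigma> E A" and N: "normal_in N E"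
  shows "permutable_in \<sigma> E (A <#> N)"
proof -
  have s: "subgroup A G" "subgroup E G" "subgroup N G" "A \<subseteq> E" "N \<subseteq> E"
    using A N by (auto simp: permutable_in_def normal_in_def)
  have c: "A \<subseteq> carrier G" "N \<subseteq> carrier G" using s subgroup.subset by blast+
  have "A <#> N <#> T = T <#> (A <#> N)" if "t \<in> \<sigma>" "hall_in t E T" for t T
  proof -
    have T: "subgroup T G" "T \<subseteq> E" using that by (auto simp: hall_in_def)
    have Tc: "T \<subseteq> carrier G" using T subgroup.subset by blast
    have "A <#> N <#> T = A <#> (T <#> N)"
      using c Tc by (simp add: set_mult_assoc normal_in_commute[OF N T])
    also have "\<dots> = T <#> A <#> N"
      using A that c Tc by (simp add: set_mult_assoc[symmetric] permutable_in_def)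
    also have "\<dots> = T <#> (A <#> N)" using c Tc by (simp add: set_mult_assoc)
    finally show ?thesis .
  qed
  then show ?thesis
    using s subgroup_set_mult_normal[OF N s(1,4)] set_mult_least[OF s(2,4,5)]
    by (simp add: permutable_in_def)
qed

text \<open>
  This is Kegel's maximality argument. Let \<open>X \<supseteq> A\<close> be maximal among the subgroups that permute with
  all Hall \<open>s\<close>-subgroups of \<open>E\<close> and whose index in \<open>E\<close> is not an \<open>s\<close>-number. For \<open>t \<in> T\<close> the
  subgroup \<open>Y\<close> generated by \<open>X\<close> and \<open>X\<^sup>t\<close> still permutes with all Hall \<open>s\<close>-subgroups, because their
  family is closed under conjugation. It lies in \<open>X T\<close>, and \<open>|X T : X|\<close> is an \<open>s\<close>-number, so
  \<open>|E : Y|\<close> is no \<open>s\<close>-number either. Thus \<open>Y = X\<close>.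
\<close>

lemma ex_proper_overgroup_normalized_by_Halls:
  assumes A: "permutable_in \<sigma> E A" and s: "s \<in> \<sigma>" and nA: "\<not> pi_number s (rel_index E A)"
  obtains X where "subgroup X G" "A \<subseteq> X" "X \<subseteq> E" "X \<noteq> E"
    "\<And>T t. hall_in s E T \<Longrightarrow> t \<in> T \<Longrightarrow> conjugate t X \<subseteq> X"
proof -
  have sub: "subgroup A G" "subgroup E G" "A \<subseteq> E" using A by (auto simp: permutable_in_def)
  have Ec: "e \<in> carrier G" if "e \<in> E" for e using that sub subgroup.mem_carrier by fastforce
  define P where "P X \<longleftrightarrow> X \<subseteq> E \<and> \<not> pi_number s (rel_index E X) \<and>
    (\<forall>T. hall_in s E T \<longrightarrow> X <#> T = T <#> X)" for X
  have "P A" using A s nA by (auto simp: P_def permutable_in_def)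
  then obtain X where X: "subgroup X G" "P X" "A \<subseteq> X"
    and max: "\<And>Y. subgroup Y G \<Longrightarrow> P Y \<Longrightarrow> X \<subseteq> Y \<Longrightarrow> Y = X"
    using ex_maximal_subgroup[OF sub(1), of P] by blast
  have XE: "X \<subseteq> E" using X by (simp add: P_def)
  have XG: "X \<subseteq> carrier G" using X(1) subgroup.subset by blast
  have "conjugate t X \<subseteq> X" if T: "hall_in s E T" and t: "t \<in> T" for T t
  proof -
    have sT: "subgroup T G" "T \<subseteq> E" "pi_number s (card T)" using T by (auto simp: hall_in_def)
    have tE: "t \<in> E" "t \<in> carrier G" using t sT Ec by auto
    have Xt: "subgroup (conjugate t X) G" by (rule subgroup_conj[OF tE(2) X(1)])
    define Y where "Y = generate G (X \<union> conjugate t X)"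
    have XT: "subgroup (X <#> T) G"
      using subgroup_set_mult_iff[OF X(1) sT(1)] X(2) T by (simp add: P_def)
    have "X \<union> conjugate t X \<subseteq> X <#> T"
    proof -
      have "conjugate t X \<subseteq> conjugate t (X <#> T)" using subset_set_mult_left[OF X(1) sT(1)] by blast
      also have "\<dots> = X <#> T"
        using conj_eq[OF XT] subset_set_mult_right[OF X(1) sT(1)] t by blast
      finally show ?thesis using subset_set_mult_left[OF X(1) sT(1)] by blast
    qed
    then have YXT: "Y \<subseteq> X <#> T" unfolding Y_def by (rule generate_subgroup_incl[OF _ XT])
    have XTE: "X <#> T \<subseteq> E" by (rule set_mult_least[OF sub(2) XE sT(2)])
    have sY: "subgroup Y G"
      unfolding Y_def using XG Xt subgroup.subset by (intro generate_is_subgroup) blast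
    have XY: "X \<subseteq> Y" "conjugate t X \<subseteq> Y" unfolding Y_def by (auto intro: generate.incl)
    have "P Y"
      unfolding P_def
    proof (intro conjI allI impI)
      show "Y \<subseteq> E" using YXT XTE by blast
      show "\<not> pi_number s (rel_index E Y)"
      proof
        assume "pi_number s (rel_index E Y)"
        then have "pi_number s (rel_index E (X <#> T))"
          using pi_number_index_mult[OF sY XT sub(2) YXT XTE] by blast
        moreover have "pi_number s (rel_index (X <#> T) X)"
        proof -
          have "X <#> T = T <#> X" using X(2) T by (simp add: P_def)
          then have "rel_index (X <#> T) X = rel_index T (T \<inter> X)"
            using rel_index_set_mult[OF sT(1) X(1)] by simp
          then show ?thesis
            using pi_number_card_subgroup(2)[OF subgroups_Inter_pair[OF sT(1) X(1)] sT(1) _ sT(3)] by simp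
        qed
        ultimately have "pi_number s (rel_index E X)"
          using pi_number_index_mult[OF X(1) XT sub(2) subset_set_mult_left[OF X(1) sT(1)] XTE] by blast
        then show False using X(2) by (simp add: P_def)
      qed
      fix U assume U: "hall_in s E U"
      have sU: "subgroup U G" using U by (simp add: hall_in_def)
      have UG: "U \<subseteq> carrier G" using sU subgroup.subset by blast
      show "Y <#> U = U <#> Y"
        unfolding Y_def
      proof (rule generate_Un_commute[OF X(1) Xt sU])
        show "X <#> U = U <#> X" using X(2) U by (simp add: P_def)
        \<comment> \<open>Conjugation by \<open>t\<close> turns \<open>X V = V X\<close> into the claim, since \<open>V\<close> is a Hall \<open>s\<close>-subgroup, too.\<close>
        define V where "V = conjugate (inv t) U"
        have it: "inv t \<in> E" using sub(2) tE(1) by (simp add: subgroup.m_inv_closed)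
        have V: "hall_in s E V" unfolding V_def by (rule hall_in_conj[OF U sub(2) it])
        have VG: "V \<subseteq> carrier G" using V subgroup.subset by (auto simp: hall_in_def)
        have "U = conjugate t V" unfolding V_def
          using conj_conj[OF tE(2) Ec[OF it] UG] conj_one[OF UG] tE(2) by simp
        then have "conjugate t X <#> U = conjugate t (X <#> V)" "U <#> conjugate t X = conjugate t (V <#> X)"
          using conj_set_mult[OF tE(2)] XG VG by auto
        moreover have "X <#> V = V <#> X" using X(2) V by (simp add: P_def)
        ultimately show "conjugate t X <#> U = U <#> conjugate t X" by simp
      qed
    qed
    then have "Y = X" using max[OF sY _ XY(1)] by simp
    then show ?thesis using XY(2) by simp
  qed
  moreover have "X \<noteq> E"
  proof
    assume "X = E"
    then have "rel_index E X = 1" using card_pos[OF sub(2)] by (simp add: rel_index_def)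
    then show False using X(2) by (simp add: P_def)
  qed
  ultimately show thesis using that X(1,3) XE by blast
qed

text \<open>
  Induction, primarily on \<open>|E|\<close> and for equal \<open>E\<close> on \<open>|E : A|\<close>; the measure \<open>2|E| - |A|\<close> decreases
  in both situations. Fix a block \<open>s\<close> for which \<open>|E : A|\<close> is not an \<open>s\<close>-number, let \<open>X\<close> be as in the
  preceding lemma and let \<open>N\<close> be generated by all Hall \<open>s\<close>-subgroups of \<open>E\<close>. If \<open>A N = E\<close>, then
  \<open>X\<close> is a proper normal subgroup of \<open>E\<close>, since it is normalised by \<open>A\<close> and by \<open>N\<close>, and induction
  applies to \<open>A\<close> in \<open>X\<close>. If \<open>A N\<close> is strictly between \<open>A\<close> and \<open>E\<close>, induction applies to \<open>A\<close> in \<open>A N\<close>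
  and to \<open>A N\<close> in \<open>E\<close>. In the remaining case \<open>N \<subseteq> A\<close>.
  
  So if \<open>A\<close> were not reachable, then for each block \<open>t\<close> either \<open>|E : A|\<close> is a \<open>t\<close>-number or \<open>A\<close>
  contains all Hall \<open>t\<close>-subgroups of \<open>E\<close>. Let \<open>s\<close> be the block of a prime divisor of \<open>|E : A|\<close>.
  The first alternative can then hold only for \<open>t = s\<close>. The Hall subgroups for the other blocks
  generate a normal subgroup of \<open>E\<close> inside \<open>A\<close> whose index is an \<open>s\<close>-number, and this makes
  \<open>A\<close> and \<open>E\<close> the ends of a primary link.
\<close>

lemma permutable_in_imp_sigma_chain:
  "permutable_in \<sigma> E A \<Longrightarrow> (sigma_step \<sigma> G)\<^sup>*\<^sup>* A E"
proof (induction "2 * card E - card A" arbitrary: E A rule: less_induct)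
  case less
  have sub: "subgroup A G" "subgroup E G" "A \<subseteq> E" using less.prems by (auto simp: permutable_in_def)
  have AE: "card A \<le> card E" by (rule card_mono[OF finite_subgroup[OF sub(2)] sub(3)])
  have conjF: "conjugate e T \<in> {T. hall_in s E T}" if "T \<in> {T. hall_in s E T}" "e \<in> E" for T e s
    using that hall_in_conj[OF _ sub(2)] by blast
  have key: "(\<forall>T. hall_in s E T \<longrightarrow> T \<subseteq> A) \<or> (sigma_step \<sigma> G)\<^sup>*\<^sup>* A E"
    if s: "s \<in> \<sigma>" and nA: "\<not> pi_number s (rel_index E A)" for s
  proof -
    obtain X where X: "subgroup X G" "A \<subseteq> X" "X \<subseteq> E" "X \<noteq> E"
      and norm: "\<And>T t. hall_in s E T \<Longrightarrow> t \<in> T \<Longrightarrow> conjugate t X \<subseteq> X"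
      using ex_proper_overgroup_normalized_by_Halls[OF less.prems s nA] by blast
    define N where "N = generate G (\<Union>{T. hall_in s E T})"
    have N: "normal_in N E" unfolding N_def
      by (rule normal_in_generate[OF sub(2) _ conjF]) (auto simp: hall_in_def)
    have sN: "subgroup N G" "N \<subseteq> E" using N by (auto simp: normal_in_def)
    define B where "B = A <#> N"
    have sB: "subgroup B G" unfolding B_def by (rule subgroup_set_mult_normal[OF N sub(1,3)])
    have AB: "A \<subseteq> B" "N \<subseteq> B"
      unfolding B_def using subset_set_mult_left[OF sub(1) sN(1)] subset_set_mult_right[OF sub(1) sN(1)] by auto
    have BE: "B \<subseteq> E" unfolding B_def by (rule set_mult_least[OF sub(2,3) sN(2)])
    show ?thesis
    proof (cases "B = E")
      case True
      have XG: "X \<subseteq> carrier G" using X(1) subgroup.subset by blast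
      have stab: "conjugate y X \<subseteq> X" if "y \<in> N" for y
        using that unfolding N_def
      proof (induction rule: generate.induct)
        case one
        then show ?case using conj_one[OF XG] by simp
      next
        case (incl y)
        then show ?case using norm by blast
      next
        case (inv y)
        then obtain T where T: "hall_in s E T" "y \<in> T" by blast
        then have "inv y \<in> T" using subgroup.m_inv_closed[of T G y] by (simp add: hall_in_def)
        then show ?case using norm[OF T(1)] by blast
      next
        case (eng y z)
        have "y \<in> carrier G" "z \<in> carrier G"
          using eng.hyps sN(1) subgroup.mem_carrier unfolding N_def by fastforce+
        then have "conjugate (y \<otimes> z) X = conjugate y (conjugate z X)" using conj_conj XG by simp
        then show ?case using eng.IH by blast
      qed
      have "conjugate e X \<subseteq> X" if "e \<in> E" for e
      proof -
        have "e \<in> A <#> N" using that True by (simp add: B_def)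
        then obtain a y where e: "a \<in> A" "y \<in> N" "e = a \<otimes> y" by (auto simp: mem_set_mult)
        have "a \<in> carrier G" "y \<in> carrier G"
          using e(1,2) sub(1) sN(1) subgroup.mem_carrier by fastforce+
        then have "conjugate e X = conjugate a (conjugate y X)" using conj_conj XG e(3) by simp
        also have "\<dots> \<subseteq> conjugate a X" using stab[OF e(2)] by blast
        also have "\<dots> \<subseteq> X" by (rule conj_subset[OF X(1)]) (use e X in auto)
        finally show ?thesis .
      qed
      then have "normal_in X E" using X sub(2) by (auto simp: normal_in_def)
      then have "sigma_step \<sigma> G X E" using X sub(2) by (simp add: sigma_step_def)
      moreover have "card X < card E"
        using X finite_subgroup[OF sub(2)] by (intro psubset_card_mono) auto
      then have "(sigma_step \<sigma> G)\<^sup>*\<^sup>* A X"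
        using permutable_in_subgroup[OF less.prems X(1,2,3)] AE card_mono[OF finite_subgroup[OF X(1)] X(2)]
        by (intro less.hyps) auto
      ultimately show ?thesis by (meson rtranclp.rtrancl_into_rtrancl)
    next
      case BnE: False
      show ?thesis
      proof (cases "N \<subseteq> A")
        case True
        then show ?thesis unfolding N_def by (auto intro: generate.incl)
      next
        case False
        have "card A < card B" using AB False finite_subgroup[OF sB] by (intro psubset_card_mono) auto
        moreover have "card B < card E" using BE BnE finite_subgroup[OF sub(2)] by (intro psubset_card_mono) auto
        moreover have "permutable_in \<sigma> E B"
          unfolding B_def by (rule permutable_in_set_mult_normal[OF less.prems N])
        moreover have "permutable_in \<sigma> B A" by (rule permutable_in_subgroup[OF less.prems sB AB(1) BE])
        ultimately have "(sigma_step \<sigma> G)\<^sup>*\<^sup>* A B" "(sigma_step \<sigma> G)\<^sup>*\<^sup>* B E"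
          by (auto intro!: less.hyps)
        then show ?thesis by (meson rtranclp_trans)
      qed
    qed
  qed
  show ?case
  proof (rule ccontr)
    assume no: "\<not> ?case"
    then have "A \<noteq> E" by auto
    then have "rel_index E A \<noteq> 1" using eq_if_index_one[OF sub(1,2,3)] by blast
    then obtain p where p: "prime p" "p dvd rel_index E A" using prime_factor_nat by blast
    obtain s where s: "s \<in> \<sigma>" "p \<in> s" using prime_partition_cover[OF partition p(1)] by blast
    have pos: "rel_index E A > 0" by (rule rel_index_pos[OF sub])
    have other: "T \<subseteq> A" if t: "t \<in> \<sigma>" "t \<noteq> s" and T: "hall_in t E T" for t T
    proof -
      have "p \<notin> t" using prime_partition_disjoint[OF partition t(1) s(1) t(2)] s(2) by blast
      then have "\<not> pi_number t (rel_index E A)"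
        using p pos by (auto simp: pi_number_def prime_factors_dvd)
      then show ?thesis using key[OF t(1)] no T by blast
    qed
    define \<F> where "\<F> = {T. \<exists>t\<in>\<sigma> - {s}. hall_in t E T}"
    define C where "C = generate G (\<Union>\<F>)"
    have "X \<subseteq> E" if "X \<in> \<F>" for X using that by (auto simp: \<F>_def hall_in_def)
    moreover have "conjugate e X \<in> \<F>" if "X \<in> \<F>" "e \<in> E" for X e
      using that hall_in_conj[OF _ sub(2)] unfolding \<F>_def by blast
    ultimately have C: "normal_in C E" unfolding C_def by (rule normal_in_generate[OF sub(2)])
    have CA: "C \<subseteq> A" unfolding C_def
      by (rule generate_subgroup_incl[OF _ sub(1)]) (use other in \<open>auto simp: \<F>_def\<close>)
    have sC: "subgroup C G" "C \<subseteq> E" using C by (auto simp: normal_in_def)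
    have "pi_number s (rel_index E C)"
      unfolding pi_number_def
    proof
      fix q assume q: "q \<in> prime_factors (rel_index E C)"
      show "q \<in> s"
      proof (rule ccontr)
        assume "q \<notin> s"
        obtain t where t: "t \<in> \<sigma>" "q \<in> t" using prime_partition_cover[OF partition] q by blast
        obtain T where T: "hall_in t E T" using ex_hall[OF t(1) sub(2)] by blast
        then have "T \<subseteq> C" unfolding C_def \<F>_def using t \<open>q \<notin> s\<close> by (auto intro: generate.incl)
        then have "pi_number (- t) (rel_index E C)"
          using pi_number_index_mult[of T C E "- t"] T sC sub(2) by (auto simp: hall_in_def)
        then show False using q t(2) by (auto simp: pi_number_def)
      qed
    qed
    then have "sigma_step \<sigma> G A E" using s(1) C CA sub by (auto simp: sigma_step_def)
    then show False using no by blast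
  qed
qed

section \<open>Normal covers of sigma-subnormal subgroups\<close>

text \<open>
  For trivial \<open>N\<close> this says that a \<open>\<sigma>\<close>-subnormal \<open>\<rho>\<close>-subgroup lies in a normal \<open>\<rho>\<close>-subgroup, where
  \<open>\<rho>\<close> respects the blocks. The proof climbs the chain. Suppose \<open>M\<close> is the cover in \<open>B\<close>, and
  consider a primary link from \<open>B\<close> to \<open>E\<close> given by \<open>C'\<close> with \<open>|E : C'|\<close> an \<open>s\<close>-number.
  
  If \<open>s\<close> is disjoint from \<open>\<rho>\<close>, then \<open>M \<subseteq> C'\<close> for arithmetical reasons, and \<open>M\<close> extends from the
  normal subgroup \<open>C'\<close> to \<open>E\<close>.
  
  If \<open>s \<subseteq> \<rho>\<close>, extend \<open>M \<inter> C'\<close> to a subgroup \<open>R\<close> that is normal in \<open>E\<close>. A Hall \<open>s\<close>-subgroup \<open>P\<close> of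
  \<open>M\<close> satisfies \<open>M = P (M \<inter> C')\<close>, and \<open>P\<close> lies in a Hall \<open>s\<close>-subgroup \<open>S\<close> of \<open>E\<close>, so \<open>M\<close> is
  contained in the subgroup \<open>Q = S R\<close>. Since \<open>E = C' S\<close> and \<open>C'\<close> normalises \<open>M\<close>, every conjugate of
  \<open>Q\<close> in \<open>E\<close> contains \<open>M\<close>. The core of \<open>Q\<close> is the required normal subgroup.
\<close>

lemma sigma_chain_normal_cover:
  assumes N: "normal_in N (carrier G)" and K: "subgroup K G" "N \<subseteq> K"
    and \<rho>: "\<And>s. s \<in> \<sigma> \<Longrightarrow> s \<subseteq> \<rho> \<or> s \<inter> \<rho> = {}"
    and KN: "pi_number \<rho> (rel_index K N)"
    and chain: "(sigma_step \<sigma> G)\<^sup>*\<^sup>* K E"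
  shows "\<exists>M. normal_in M E \<and> K \<subseteq> M \<and> pi_number \<rho> (rel_index M N)"
  using chain
proof (induction rule: rtranclp_induct)
  case base
  then show ?case using normal_in_self[OF K(1)] KN by blast
next
  case (step B E)
  have sN: "subgroup N G" using N by (simp add: normal_in_def)
  have sub: "subgroup B G" "subgroup E G" "B \<subseteq> E" using step.hyps(2) by (auto simp: sigma_step_def)
  obtain M where M: "normal_in M B" "K \<subseteq> M" "pi_number \<rho> (rel_index M N)"
    using step.IH by blast
  have sM: "subgroup M G" "M \<subseteq> B" using M by (auto simp: normal_in_def)
  have NM: "N \<subseteq> M" using K M by blast
  have NE: "normal_in N E"
    using normal_in_restrict[OF N sub(2)] NM sM sub subgroup.subset by blast
  have NB: "normal_in N B" by (rule normal_in_restrict[OF NE sub(1) _ sub(3)]) (use NM sM in blast)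
  from step.hyps(2) consider (norm) "normal_in B E"
    | (prim) s C where "s \<in> \<sigma>" "normal_in C E" "C \<subseteq> B" "pi_number s (rel_index E C)"
    by (auto simp: sigma_step_def)
  then show ?case
  proof cases
    case norm
    obtain R where "normal_in R E" "M \<subseteq> R" "pi_number \<rho> (rel_index R N)"
      using normal_in_extend[OF NE norm M(1) NM M(3)] by blast
    then show ?thesis using M(2) by blast
  next
    case prim
    \<comment> \<open>Enlarging \<open>C\<close> by \<open>N\<close> keeps the link primary and makes the indices over \<open>N\<close> meaningful.\<close>
    define C' where "C' = C <#> N"
    have C': "normal_in C' E" unfolding C'_def by (rule normal_in_set_mult[OF prim(2) NE])
    have sC: "subgroup C G" "subgroup C' G" using prim(2) C' by (auto simp: normal_in_def)
    have CC': "C \<subseteq> C'" "N \<subseteq> C'"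
      unfolding C'_def using subset_set_mult_left[OF sC(1) sN] subset_set_mult_right[OF sC(1) sN] by auto
    have C'B: "C' \<subseteq> B" unfolding C'_def
      by (rule set_mult_least[OF sub(1) prim(3)]) (use NM sM in blast)
    have C'E: "C' \<subseteq> E" using C'B sub(3) by blast
    have sidx: "pi_number s (rel_index E C')"
      using pi_number_index_mult[OF sC sub(2) CC'(1) C'E] prim(4) by blast
    have ME: "M \<subseteq> E" using sM sub by blast
    define L where "L = M \<inter> C'"
    have sL: "subgroup L G" unfolding L_def by (rule subgroups_Inter_pair[OF sM(1) sC(2)])
    have NL: "N \<subseteq> L" unfolding L_def using NM CC' by blast
    have MLs: "pi_number s (rel_index M L)"
      unfolding L_def by (rule pi_number_index_Int[OF C' sM(1) ME sidx])
    have idx: "pi_number \<rho> (rel_index M L)" "pi_number \<rho> (rel_index L N)"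
      using pi_number_index_mult[OF sN sL sM(1) NL] M(3) unfolding L_def by blast+
    have LC': "normal_in L C'"
      using normal_in_Int[OF M(1) sC(2)] C'B unfolding L_def by (simp add: Int_absorb1)
    obtain R where R: "normal_in R E" "L \<subseteq> R" "R \<subseteq> C'" "pi_number \<rho> (rel_index R N)"
      using normal_in_extend[OF NE C' LC' NL idx(2)] by blast
    have sR: "subgroup R G" "R \<subseteq> E" using R(1) by (auto simp: normal_in_def)
    show ?thesis
    proof (cases "s \<subseteq> \<rho>")
      case False
      then have "s \<inter> \<rho> = {}" using \<rho> prim(1) by blast
      then have "L = M"
        using eq_if_index_pi_numbers[OF sL sM(1) _ MLs idx(1)] by (simp add: L_def)
      then show ?thesis using R M(2) by blast
    next
      case True
      obtain P where P: "hall_in s M P" using ex_hall[OF prim(1) sM(1)] by blast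
      then have sP: "subgroup P G" "P \<subseteq> M" "pi_number s (card P)" by (auto simp: hall_in_def)
      obtain S where S: "hall_in s E S" "P \<subseteq> S"
        using ex_hall_containing[OF prim(1) sub(2) sP(1) _ sP(3)] sP(2) ME by blast
      have sS: "subgroup S G" "S \<subseteq> E" "pi_number s (card S)" using S by (auto simp: hall_in_def)
      have LM: "normal_in L M"
        using normal_in_Int[OF C' sM(1)] ME by (simp add: L_def Int_commute Int_absorb1)
      have "P <#> L = M"
      proof (rule eq_if_index_pi_numbers[of _ _ s "- s"])
        show sPL: "subgroup (P <#> L) G" by (rule subgroup_set_mult_normal[OF LM sP(1,2)])
        show PLM: "P <#> L \<subseteq> M" by (rule set_mult_least[OF sM(1) sP(2)]) (simp add: L_def)
        show "pi_number s (rel_index M (P <#> L))"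
          using pi_number_index_mult[OF sL sPL sM(1) subset_set_mult_right[OF sP(1) sL] PLM] MLs by blast
        show "pi_number (- s) (rel_index M (P <#> L))"
          using pi_number_index_mult[OF sP(1) sPL sM(1) subset_set_mult_left[OF sP(1) sL] PLM] P
          by (simp add: hall_in_def)
      qed (use sM in auto)
      define Q where "Q = S <#> R"
      have MQ: "M \<subseteq> Q" unfolding Q_def \<open>P <#> L = M\<close>[symmetric] by (rule mono_set_mult[OF S(2) R(2)])
      have sQ: "subgroup Q G" unfolding Q_def by (rule subgroup_set_mult_normal[OF R(1) sS(1,2)])
      have RQ: "R \<subseteq> Q" "S \<subseteq> Q" unfolding Q_def
        using subset_set_mult_right[OF sS(1) sR(1)] subset_set_mult_left[OF sS(1) sR(1)] by auto
      have QE: "Q \<subseteq> E" unfolding Q_def by (rule set_mult_least[OF sub(2) sS(2) sR(2)])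
      have QG: "Q \<subseteq> carrier G" using sQ subgroup.subset by blast
      have "S <#> C' = E"
      proof (rule eq_if_index_pi_numbers[of _ _ s "- s"])
        show sSC: "subgroup (S <#> C') G" by (rule subgroup_set_mult_normal[OF C' sS(1,2)])
        show SCE: "S <#> C' \<subseteq> E" by (rule set_mult_least[OF sub(2) sS(2) C'E])
        show "pi_number s (rel_index E (S <#> C'))"
          using pi_number_index_mult[OF sC(2) sSC sub(2) subset_set_mult_right[OF sS(1) sC(2)] SCE] sidx
          by blast
        show "pi_number (- s) (rel_index E (S <#> C'))"
          using pi_number_index_mult[OF sS(1) sSC sub(2) subset_set_mult_left[OF sS(1) sC(2)] SCE] S(1)
          by (simp add: hall_in_def)
      qed (use sub in auto)
      then have CS: "C' <#> S = E" using normal_in_commute[OF C' sS(1,2)] by simp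
      have MgQ: "M \<subseteq> conjugate g Q" if g: "g \<in> E" for g
      proof -
        obtain c x where cx: "c \<in> C'" "x \<in> S" "g = c \<otimes> x"
          using g CS by (auto simp: mem_set_mult)
        have c: "c \<in> carrier G" "x \<in> carrier G" using cx(1,2) sC(2) sS(1) subgroup.mem_carrier by fastforce+
        have "M = conjugate c M" using normal_in_conj_eq[OF M(1)] cx(1) C'B by blast
        also have "\<dots> \<subseteq> conjugate c Q" using MQ by blast
        also have "\<dots> = conjugate c (conjugate x Q)" using conj_eq[OF sQ] cx(2) RQ by blast
        also have "\<dots> = conjugate g Q" using conj_conj[OF c QG] cx(3) by simp
        finally show ?thesis .
      qed
      define W where "W = (\<Inter>g\<in>E. conjugate g Q)"
      have W: "normal_in W E" unfolding W_def by (rule normal_in_core[OF sub(2) sQ QE])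
      have sW: "subgroup W G" using W by (simp add: normal_in_def)
      have MW: "M \<subseteq> W" unfolding W_def using MgQ by blast
      have WQ: "W \<subseteq> Q" unfolding W_def using conj_one[OF QG] subgroup.one_closed[OF sub(2)] by blast
      have "rel_index Q R = rel_index S (S \<inter> R)" unfolding Q_def by (rule rel_index_set_mult[OF sS(1) sR(1)])
      then have "pi_number s (rel_index Q R)"
        using pi_number_card_subgroup(2)[OF subgroups_Inter_pair[OF sS(1) sR(1)] sS(1) _ sS(3)] by simp
      then have "pi_number \<rho> (rel_index Q R)" using True by (rule pi_number_mono)
      then have "pi_number \<rho> (rel_index Q N)"
        using pi_number_index_mult[OF sN sR(1) sQ _ RQ(1)] NL R(2,4) by blast
      then have "pi_number \<rho> (rel_index W N)"
        using pi_number_index_mult[OF sN sW sQ _ WQ] NM MW by blast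
      then show ?thesis using W MW M(2) by blast
    qed
  qed
qed

text \<open>
  The last step of the proof, isolated from \<open>\<sigma>\<close>-permutability: \<open>K\<close> and \<open>T\<close> permute in \<open>G\<close> as soon
  as they permute modulo \<open>D\<close>. Everything rests on \<open>Int_D\<close> below, applied to the normal cover \<open>M\<close>
  of \<open>K\<close> if \<open>T \<subseteq> D\<close>, and to \<open>M T\<close> otherwise.
\<close>

lemma commute_if_commute_modulo_normal_hall:
  assumes D: "normal_in D (carrier G)" "pi_number \<pi> (card D)" "pi_number (- \<pi>) (rel_index (carrier G) D)"
    and \<pi>: "\<And>s. s \<in> \<sigma> \<Longrightarrow> s \<subseteq> \<pi> \<or> s \<inter> \<pi> = {}"
    and K: "subgroup K G" "(sigma_step \<sigma> G)\<^sup>*\<^sup>* K (carrier G)" "normal_in (K \<inter> D) (carrier G)"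
    and T: "s \<in> \<sigma>" "subgroup T G" "pi_number s (card T)"
    and KDT: "subgroup ((K <#> D) <#> T) G"
  shows "K <#> T = T <#> K"
proof -
  define N where "N = K \<inter> D"
  have sD: "subgroup D G" using D by (simp add: normal_in_def)
  have sN: "subgroup N G" unfolding N_def by (rule subgroups_Inter_pair[OF K(1) sD])
  have c: "K \<subseteq> carrier G" "T \<subseteq> carrier G" "D \<subseteq> carrier G"
    using K(1) T(2) sD subgroup.subset by blast+
  have "pi_number (- \<pi>) (rel_index K N)"
    unfolding N_def by (rule pi_number_index_Int[OF D(1) K(1) c(1) D(3)])
  moreover have "t \<subseteq> - \<pi> \<or> t \<inter> - \<pi> = {}" if "t \<in> \<sigma>" for t using \<pi>[OF that] by blast
  ultimately obtain M where M: "normal_in M (carrier G)" "K \<subseteq> M" "pi_number (- \<pi>) (rel_index M N)"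
    using sigma_chain_normal_cover[of N K "- \<pi>", OF K(3)[folded N_def] K(1) _ _ _ K(2)] N_def by blast
  have sM: "subgroup M G" using M by (simp add: normal_in_def)
  have NM: "N \<subseteq> M" using M N_def by blast
  have Int_D: "Q \<inter> D = N" if Q: "subgroup Q G" "N \<subseteq> Q" "pi_number (- \<pi>) (rel_index Q N)" for Q
  proof -
    have sQD: "subgroup (Q \<inter> D) G" by (rule subgroups_Inter_pair[OF Q(1) sD])
    have NQD: "N \<subseteq> Q \<inter> D" using Q(2) N_def by blast
    have "pi_number (- \<pi>) (rel_index (Q \<inter> D) N)"
      using pi_number_index_mult[OF sN sQD Q(1) NQD] Q(3) by blast
    moreover have "pi_number \<pi> (rel_index (Q \<inter> D) N)"
      by (intro pi_number_card_subgroup(2)[OF sN sQD NQD] pi_number_card_subgroup(1)[OF sQD sD _ D(2)]) simp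
    ultimately show ?thesis using eq_if_index_pi_numbers[OF sN sQD NQD, of \<pi> "- \<pi>"] by simp
  qed
  show ?thesis
  proof (cases "s \<subseteq> \<pi>")
    case True
    have "T \<inter> D = T"
    proof (rule eq_if_index_pi_numbers[of _ _ \<pi> "- \<pi>"])
      show sTD: "subgroup (T \<inter> D) G" by (rule subgroups_Inter_pair[OF T(2) sD])
      show "pi_number \<pi> (rel_index T (T \<inter> D))"
        by (rule pi_number_mono[OF pi_number_card_subgroup(2)[OF sTD T(2) _ T(3)] True]) simp
      show "pi_number (- \<pi>) (rel_index T (T \<inter> D))"
        by (rule pi_number_index_Int[OF D(1) T(2) c(2) D(3)])
    qed (use T in auto)
    then have TD: "T \<subseteq> D" by blast
    show ?thesis
    proof (rule set_mult_commute_if_subset[OF K(1) T(2)])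
      show "K <#> T \<subseteq> T <#> K"
      proof
        fix y assume "y \<in> K <#> T"
        then obtain k t where kt: "k \<in> K" "t \<in> T" "y = k \<otimes> t" by (auto simp: mem_set_mult)
        have ktc: "k \<in> carrier G" "t \<in> carrier G" using kt c by auto
        have inv: "inv k \<in> M" "inv t \<in> D" "inv t \<in> carrier G"
          using kt M(2) TD sM sD ktc by (auto intro: subgroup.m_inv_closed)
        \<comment> \<open>The commutator of \<open>k\<close> and \<open>t\<close> lies in \<open>M \<inter> D = N\<close>; moving it to the right of \<open>t\<close> keeps it
          in \<open>N \<subseteq> K\<close>.\<close>
        have "k \<otimes> (t \<otimes> inv k \<otimes> inv t) \<in> M"
          using normal_in_conj[OF M(1) ktc(2) inv(1)] kt(1) M(2) sM by (blast intro: subgroup.m_closed)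
        moreover have "k \<otimes> t \<otimes> inv k \<otimes> inv t \<in> D"
          using normal_in_conj[OF D(1) ktc(1), of t] kt(2) TD inv(2) sD by (blast intro: subgroup.m_closed)
        ultimately have "k \<otimes> t \<otimes> inv k \<otimes> inv t \<in> N"
          using Int_D[OF sM NM M(3)] ktc by (auto simp: m_assoc)
        then have n: "inv t \<otimes> (k \<otimes> t \<otimes> inv k \<otimes> inv t) \<otimes> inv (inv t) \<in> N"
          using normal_in_conj[OF K(3) inv(3)] by (simp add: N_def)
        then have "inv t \<otimes> (k \<otimes> t \<otimes> inv k \<otimes> inv t) \<otimes> inv (inv t) \<otimes> k \<in> K"
          using kt(1) K(1) by (auto simp: N_def intro: subgroup.m_closed)
        moreover have "y = t \<otimes> (inv t \<otimes> (k \<otimes> t \<otimes> inv k \<otimes> inv t) \<otimes> inv (inv t) \<otimes> k)"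
          using ktc kt(3) by (simp add: m_assoc mult_inv_cancel)
        ultimately show "y \<in> T <#> K" using kt(2) by (metis set_multI)
      qed
    qed
  next
    case False
    then have s\<pi>: "s \<subseteq> - \<pi>" using \<pi>[OF T(1)] by blast
    define Q where "Q = T <#> M"
    have sQ: "subgroup Q G" unfolding Q_def by (rule subgroup_set_mult_normal[OF M(1) T(2) c(2)])
    have MQ: "M \<subseteq> Q" "T \<subseteq> Q" unfolding Q_def
      using subset_set_mult_right[OF T(2) sM] subset_set_mult_left[OF T(2) sM] by auto
    have "rel_index Q M = rel_index T (T \<inter> M)" unfolding Q_def by (rule rel_index_set_mult[OF T(2) sM])
    then have "pi_number s (rel_index Q M)"
      using pi_number_card_subgroup(2)[OF subgroups_Inter_pair[OF T(2) sM] T(2) _ T(3)] by simp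
    then have "pi_number (- \<pi>) (rel_index Q M)" using s\<pi> by (rule pi_number_mono)
    then have "pi_number (- \<pi>) (rel_index Q N)"
      using pi_number_index_mult[OF sN sM sQ NM MQ(1)] M(3) by blast
    then have QD: "Q \<inter> D = N" using NM MQ(1) by (intro Int_D[OF sQ]) auto
    have sKD: "subgroup (K <#> D) G" by (rule subgroup_set_mult_normal[OF D(1) K(1) c(1)])
    have "K <#> T = Q \<inter> ((K <#> D) <#> T)"
    proof
      show "K <#> T \<subseteq> Q \<inter> ((K <#> D) <#> T)"
        using set_mult_least[OF sQ _ MQ(2), of K] M(2) MQ(1)
          mono_set_mult[OF subset_set_mult_left[OF K(1) sD] order_refl[of T]] by blast
      show "Q \<inter> ((K <#> D) <#> T) \<subseteq> K <#> T"
      proof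
        fix y assume "y \<in> Q \<inter> ((K <#> D) <#> T)"
        then obtain k d t where y: "y \<in> Q" "k \<in> K" "d \<in> D" "t \<in> T" "y = k \<otimes> d \<otimes> t"
          by (auto simp: mem_set_mult)
        have yc: "k \<in> carrier G" "d \<in> carrier G" "t \<in> carrier G" using y c by auto
        have "d = inv k \<otimes> y \<otimes> inv t" using yc y(5) by (simp add: m_assoc mult_inv_cancel)
        moreover have "inv k \<in> Q" "inv t \<in> Q"
          using y M(2) MQ subgroup.m_inv_closed[OF sQ] by blast+
        ultimately have "d \<in> Q" using y(1) sQ by (simp add: subgroup.m_closed)
        then have "d \<in> K" using QD y(3) N_def by blast
        then have "k \<otimes> d \<in> K" using y(2) K(1) by (simp add: subgroup.m_closed)
        then show "y \<in> K <#> T" using y(4,5) by (simp add: set_multI)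
      qed
    qed
    then have "subgroup (K <#> T) G" using subgroups_Inter_pair[OF sQ KDT] by simp
    then show ?thesis using subgroup_set_mult_iff[OF K(1) T(2)] by simp
  qed
qed

end

section \<open>Sigma-permutability in the quotient\<close>

context finite_group
begin

lemma permutable_in_if_sigma_permutable:
  assumes "sigma_permutable \<sigma> (G\<lparr>carrier := E\<rparr>) A" "subgroup E G"
  shows "permutable_in \<sigma> E A"
  using assms by (auto simp: sigma_permutable_def permutable_in_def subgroup_restrict_iff hall_in_iff)

text \<open>
  One Hall subgroup is chosen for each block that divides \<open>|E|\<close>. Uniqueness inside the chosen set
  needs that a Hall \<open>s\<close>-subgroup for such a block \<open>s\<close> is nontrivial, so that it is not at the
  same time the subgroup chosen for another block.
\<close>

lemma ex_complete_Hall_set: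
  assumes part: "prime_partition \<sigma>" and E: "subgroup E G" and hall: "\<And>s. s \<in> \<sigma> \<Longrightarrow> \<exists>T. hall_in s E T"
  shows "\<exists>\<H>. complete_Hall_set \<sigma> (G\<lparr>carrier := E\<rparr>) \<H>"
proof -
  obtain f where f: "\<And>s. s \<in> \<sigma> \<Longrightarrow> hall_in s E (f s)" using hall by metis
  define \<H> where "\<H> = f ` sigma_of \<sigma> (card E)"
  have sub: "sigma_of \<sigma> (card E) \<subseteq> \<sigma>" by (auto simp: sigma_of_def)
  have "s = t" if s: "s \<in> sigma_of \<sigma> (card E)" and t: "t \<in> \<sigma>" "hall_in s E (f t)" for s t
  proof (rule ccontr)
    assume "s \<noteq> t"
    then have disj: "s \<inter> t = {}"
      using prime_partition_disjoint[OF part] s t(1) sub by blast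
    obtain p where p: "p \<in> s" "p \<in> prime_factors (card E)" using s by (auto simp: sigma_of_def)
    have T: "subgroup (f t) G" "f t \<subseteq> E" "pi_number t (card (f t))" "pi_number (- s) (rel_index E (f t))"
      using f[OF t(1)] t(2) by (auto simp: hall_in_def)
    have pp: "prime p" "p dvd card E" using p(2) by auto
    then have "p dvd rel_index E (f t) \<or> p dvd card (f t)"
      using card_eq_index_mult[OF T(1) E T(2)] by (simp add: prime_dvd_mult_iff)
    then show False
      using T p(1) pp disj rel_index_pos[OF T(1) E T(2)] card_pos[OF T(1)]
      by (auto simp: pi_number_def prime_factors_dvd)
  qed
  then have "\<exists>!H. H \<in> \<H> \<and> hall_in s E H" if "s \<in> sigma_of \<sigma> (card E)" for s
    using that f sub unfolding \<H>_def by (intro ex1I[of _ "f s"]) blast+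
  moreover have "\<forall>H\<in>\<H>. \<exists>s\<in>\<sigma>. hall_in s E H" using f sub unfolding \<H>_def by blast
  ultimately have "complete_Hall_set \<sigma> (G\<lparr>carrier := E\<rparr>) \<H>"
    using E by (auto simp: complete_Hall_set_def hall_in_iff order_def subgroup_restrict_iff)
      (auto simp: hall_in_def)
  then show ?thesis by blast
qed

end

locale sigma_full_quotient = sigma_full_group +
  fixes D
  assumes D: "D \<lhd> G"
begin

abbreviation proj :: "'a \<Rightarrow> 'a set" where
  "proj x \<equiv> D #>\<^bsub>G\<^esub> x"

sublocale Q: finite_group "G Mod D"
proof -
  interpret Q: group "G Mod D" by (rule normal.factorgroup_is_group[OF D])
  show "finite_group (G Mod D)"
    by unfold_locales (simp add: carrier_FactGroup finite_carrier)
qed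

sublocale proj: group_hom G "G Mod D" proj
  using normal.r_coset_hom_Mod[OF D] by unfold_locales

lemma D_in: "normal_in D (carrier G)"
  using D normal_in_carrier_iff by blast

lemma subgroup_D: "subgroup D G"
  using D_in by (simp add: normal_in_def)

lemma proj_eq_one_iff: "x \<in> carrier G \<Longrightarrow> proj x = \<one>\<^bsub>G Mod D\<^esub> \<longleftrightarrow> x \<in> D"
  using coset_join1[of D x] coset_join2[of x D] subgroup_D by auto

lemma proj_eq_iff:
  assumes "x \<in> carrier G" "y \<in> carrier G"
  shows "proj x = proj y \<longleftrightarrow> x \<otimes> inv y \<in> D"
proof -
  have "proj (x \<otimes> inv y) = proj x \<otimes>\<^bsub>G Mod D\<^esub> inv\<^bsub>G Mod D\<^esub> proj y"
    using assms by (metis inv_closed proj.hom_inv proj.hom_mult)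
  moreover have "proj x \<otimes>\<^bsub>G Mod D\<^esub> inv\<^bsub>G Mod D\<^esub> proj y = \<one>\<^bsub>G Mod D\<^esub> \<longleftrightarrow> proj x = proj y"
    using assms by (metis Q.inv_equality Q.inv_inv Q.r_inv Q.inv_closed proj.hom_closed)
  ultimately show ?thesis using proj_eq_one_iff[of "x \<otimes> inv y"] assms by simp
qed

lemma proj_mult_D:
  assumes "x \<in> carrier G" "d \<in> D"
  shows "proj (x \<otimes> d) = proj x"
proof -
  have d: "d \<in> carrier G" using assms subgroup_D subgroup.mem_carrier by fastforce
  then show ?thesis
    using proj_eq_iff[of "x \<otimes> d" x] normal_in_conj[OF D_in assms] assms(1) by (simp del: proj.hom_mult)
qed

lemma proj_set_mult: "A \<subseteq> carrier G \<Longrightarrow> B \<subseteq> carrier G \<Longrightarrow> proj ` (A <#> B) = proj ` A <#>\<^bsub>G Mod D\<^esub> proj ` B"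
  by (rule set_mult_hom[OF proj.homh])

text \<open>
  The image of \<open>H\<close> consists of the cosets of \<open>D\<close> in \<open>H D\<close>.
\<close>

lemma card_proj:
  assumes H: "subgroup H G"
  shows "card (proj ` H) = rel_index H (H \<inter> D)"
proof -
  have HG: "H \<subseteq> carrier G" using H subgroup.subset by blast
  have sHD: "subgroup (H <#> D) G" by (rule subgroup_set_mult_normal[OF D_in H HG])
  have "proj (h \<otimes> d) = proj h" if "h \<in> H" "d \<in> D" for h d
    using that HG by (intro proj_mult_D) auto
  then have "proj ` (H <#> D) = proj ` H"
    using subset_set_mult_left[OF H subgroup_D] by (auto simp: mem_set_mult image_iff) blast
  moreover have "rcosets\<^bsub>G\<lparr>carrier := H <#> D\<rparr>\<^esub> D = proj ` (H <#> D)"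
    by (auto simp: RCOSETS_def)
  ultimately show ?thesis
    using card_rcosets[OF subgroup_D sHD subset_set_mult_right[OF H subgroup_D]]
      rel_index_set_mult[OF H subgroup_D] by simp
qed

lemma rel_index_proj:
  assumes F: "subgroup F G" and E: "subgroup E G" and FE: "F \<subseteq> E" "E \<inter> D \<subseteq> F"
  shows "rel_index (proj ` E) (proj ` F) = rel_index E F"
proof -
  have "F \<inter> D = E \<inter> D" using FE by blast
  then have "card (proj ` E) = rel_index E F * card (proj ` F)"
    using card_proj[OF F] card_proj[OF E] rel_index_mult[OF subgroups_Inter_pair[OF E subgroup_D] F E FE(2,1)]
    by simp
  moreover have "card (proj ` F) > 0"
    using Q.card_pos proj.subgroup_img_is_subgroup[OF F] by blast
  ultimately show ?thesis by (simp add: rel_index_def)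
qed

text \<open>
  Replacing \<open>T\<close> by \<open>F = T (E \<inter> D)\<close> keeps the image, and the index of the image of \<open>F\<close> is the index
  of \<open>F\<close> itself, because \<open>F\<close> contains \<open>E \<inter> D\<close>.
\<close>

lemma hall_in_proj:
  assumes E: "subgroup E G" and T: "hall_in s E T"
  shows "Q.hall_in s (proj ` E) (proj ` T)"
proof -
  have sT: "subgroup T G" "T \<subseteq> E" "pi_number s (card T)" "pi_number (- s) (rel_index E T)"
    using T by (auto simp: hall_in_def)
  define F where "F = T <#> (E \<inter> D)"
  have ED: "normal_in (E \<inter> D) E"
    using normal_in_Int[OF D_in E] subgroup.subset[OF E] by (simp add: Int_absorb1 Int_absorb2 Int_commute)
  then have sED: "subgroup (E \<inter> D) G" by (simp add: normal_in_def)
  have sF: "subgroup F G" unfolding F_def by (rule subgroup_set_mult_normal[OF ED sT(1,2)])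
  have F: "T \<subseteq> F" "E \<inter> D \<subseteq> F" unfolding F_def
    using subset_set_mult_left[OF sT(1) sED] subset_set_mult_right[OF sT(1) sED] by auto
  have FE: "F \<subseteq> E" unfolding F_def by (rule set_mult_least[OF E sT(2)]) simp
  have "proj ` F = proj ` T"
  proof
    show "proj ` F \<subseteq> proj ` T"
    proof (rule image_subsetI)
      fix x assume "x \<in> F"
      then obtain t d where x: "t \<in> T" "d \<in> D" "x = t \<otimes> d" by (auto simp: F_def mem_set_mult)
      then have "proj x = proj t" using proj_mult_D subgroup.mem_carrier[OF sT(1)] by blast
      then show "proj x \<in> proj ` T" using x(1) by blast
    qed
  qed (use F in blast)
  moreover have "pi_number (- s) (rel_index E F)"
    using pi_number_index_mult[OF sT(1) sF E F(1) FE] sT(4) by blast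
  then have "pi_number (- s) (rel_index (proj ` E) (proj ` F))"
    using rel_index_proj[OF sF E FE F(2)] by simp
  moreover have "pi_number s (card (proj ` T))"
    unfolding card_proj[OF sT(1)]
    by (rule pi_number_card_subgroup(2)[OF subgroups_Inter_pair[OF sT(1) subgroup_D] sT(1) _ sT(3)]) simp
  ultimately show ?thesis
    using proj.subgroup_img_is_subgroup[OF sT(1)] sT(2) by (auto simp: Q.hall_in_def)
qed

text \<open>
  Let \<open>F\<close> be the preimage of \<open>V\<close> in \<open>E\<close>. A Hall \<open>s\<close>-subgroup \<open>T\<close> of \<open>F\<close> covers \<open>V\<close>, because the index of
  \<open>T (E \<inter> D)\<close> in \<open>F\<close> divides both an \<open>s\<close>-number and an \<open>s'\<close>-number; and \<open>T\<close> is a Hall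
  subgroup of \<open>E\<close>, because \<open>|E : F|\<close> is the index of \<open>V\<close>.
\<close>

lemma hall_in_proj_lift:
  assumes E: "subgroup E G" and s: "s \<in> \<sigma>" and V: "Q.hall_in s (proj ` E) V"
  obtains T where "hall_in s E T" "V = proj ` T"
proof -
  have sV: "subgroup V (G Mod D)" "V \<subseteq> proj ` E" "pi_number s (card V)"
    "pi_number (- s) (rel_index (proj ` E) V)"
    using V by (auto simp: Q.hall_in_def)
  define F where "F = {x \<in> E. proj x \<in> V}"
  have EG: "E \<subseteq> carrier G" using E subgroup.subset by blast
  have sF: "subgroup F G"
  proof (rule subgroupI)
    show "F \<noteq> {}"
      using subgroup.one_closed[OF E] subgroup.one_closed[OF sV(1)] proj.hom_one unfolding F_def by auto
    show "inv x \<in> F" if "x \<in> F" for x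
      using that subgroup.m_inv_closed[OF E, of x] subgroup.m_inv_closed[OF sV(1), of "proj x"] EG
        proj.hom_inv[of x]
      unfolding F_def by (auto simp: subset_iff)
    show "x \<otimes> y \<in> F" if "x \<in> F" "y \<in> F" for x y
      using that subgroup.m_closed[OF E] subgroup.m_closed[OF sV(1), of "proj x" "proj y"] EG
        proj.hom_mult[of x y]
      unfolding F_def by (auto simp: subset_iff)
  qed (use EG F_def in auto)
  have FE: "F \<subseteq> E" by (auto simp: F_def)
  have VF: "V = proj ` F" using sV(2) by (auto simp: F_def)
  have "proj x \<in> V" if "x \<in> E \<inter> D" for x
    using that EG proj_eq_one_iff[of x] subgroup.one_closed[OF sV(1)] by auto
  then have EDF: "E \<inter> D \<subseteq> F" by (auto simp: F_def)
  then have FD: "F \<inter> D = E \<inter> D" using FE by blast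
  have sED: "subgroup (E \<inter> D) G" by (rule subgroups_Inter_pair[OF E subgroup_D])
  have idxF: "pi_number s (rel_index F (E \<inter> D))"
    using card_proj[OF sF] sV(3) VF FD by simp
  have idxE: "pi_number (- s) (rel_index E F)"
    using rel_index_proj[OF sF E FE EDF] sV(4) VF by simp
  obtain T where T: "hall_in s F T" using ex_hall[OF s sF] by blast
  then have sT: "subgroup T G" "T \<subseteq> F" "pi_number s (card T)" "pi_number (- s) (rel_index F T)"
    by (auto simp: hall_in_def)
  have "normal_in (E \<inter> D) F"
    using normal_in_Int[OF D_in sF] FD subgroup.subset[OF sF] by (simp add: Int_absorb1 Int_absorb2 Int_commute)
  then have sTD: "subgroup (T <#> (E \<inter> D)) G" by (rule subgroup_set_mult_normal[OF _ sT(1,2)])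
  have "T <#> (E \<inter> D) = F"
  proof (rule eq_if_index_pi_numbers[of _ _ s "- s"])
    show TDF: "T <#> (E \<inter> D) \<subseteq> F" by (rule set_mult_least[OF sF sT(2) EDF])
    show "pi_number s (rel_index F (T <#> (E \<inter> D)))"
      using pi_number_index_mult[OF sED sTD sF subset_set_mult_right[OF sT(1) sED] TDF] idxF by blast
    show "pi_number (- s) (rel_index F (T <#> (E \<inter> D)))"
      using pi_number_index_mult[OF sT(1) sTD sF subset_set_mult_left[OF sT(1) sED] TDF] sT(4) by blast
  qed (use sTD sF in auto)
  have "V = proj ` T"
  proof
    show "V \<subseteq> proj ` T"
    proof
      fix v assume "v \<in> V"
      then obtain x where x: "x \<in> F" "v = proj x" using VF by blast
      then obtain t d where td: "t \<in> T" "d \<in> D" "x = t \<otimes> d"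
        using \<open>T <#> (E \<inter> D) = F\<close>[symmetric] by (auto simp: mem_set_mult)
      then have "proj x = proj t" using proj_mult_D subgroup.mem_carrier[OF sT(1)] by blast
      then show "v \<in> proj ` T" using x(2) td(1) by blast
    qed
  qed (use VF sT(2) in blast)
  moreover have "hall_in s E T"
    using pi_number_index_mult[OF sT(1) sF E sT(2) FE] idxE sT FE by (auto simp: hall_in_def)
  ultimately show thesis using that by blast
qed

text \<open>
  Lifting the Hall subgroups of the image of \<open>E\<close> reduces the commutation of \<open>V\<close> with the image of
  \<open>A\<close> to the commutation of \<open>A\<close> with a Hall subgroup of \<open>E\<close>.
\<close>

lemma sigma_permutable_proj:
  assumes A: "permutable_in \<sigma> E A"
  shows "sigma_permutable \<sigma> ((G Mod D)\<lparr>carrier := proj ` E\<rparr>) (proj ` A)"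
proof -
  have sub: "subgroup E G" "subgroup A G" "A \<subseteq> E" using A by (auto simp: permutable_in_def)
  have sE: "subgroup (proj ` E) (G Mod D)" by (rule proj.subgroup_img_is_subgroup[OF sub(1)])
  have "\<exists>\<H>. complete_Hall_set \<sigma> ((G Mod D)\<lparr>carrier := proj ` E\<rparr>) \<H>"
    using ex_hall[OF _ sub(1)] hall_in_proj[OF sub(1)] by (intro Q.ex_complete_Hall_set[OF partition sE]) blast
  moreover have "proj ` A <#>\<^bsub>G Mod D\<^esub> V = V <#>\<^bsub>G Mod D\<^esub> proj ` A"
    if s: "s \<in> \<sigma>" and V: "Q.hall_in s (proj ` E) V" for s V
  proof -
    obtain T where T: "hall_in s E T" "V = proj ` T" using hall_in_proj_lift[OF sub(1) s V] by blast
    have c: "A \<subseteq> carrier G" "T \<subseteq> carrier G"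
      using sub T subgroup.subset by (auto simp: hall_in_def)
    have "A <#> T = T <#> A" using A s T(1) by (simp add: permutable_in_def)
    then show ?thesis
      unfolding T(2) proj_set_mult[OF c, symmetric] proj_set_mult[OF c(2,1), symmetric] by simp
  qed
  ultimately show ?thesis
    using Q.hall_in_iff[OF sE] Q.subgroup_restrict_iff[OF sE] proj.subgroup_img_is_subgroup[OF sub(2)] sub(3)
    unfolding sigma_permutable_def set_mult_consistent by blast
qed

text \<open>
  The sets \<open>K D T\<close> and \<open>T K D\<close> are the full preimages of the two products of images.
\<close>

lemma subgroup_set_mult_if_proj_commute:
  assumes K: "subgroup K G" and T: "subgroup T G"
    and comm: "proj ` K <#>\<^bsub>G Mod D\<^esub> proj ` T = proj ` T <#>\<^bsub>G Mod D\<^esub> proj ` K"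
  shows "subgroup ((K <#> D) <#> T) G"
proof -
  have c: "K \<subseteq> carrier G" "T \<subseteq> carrier G" using K T subgroup.subset by blast+
  have sKD: "subgroup (K <#> D) G" by (rule subgroup_set_mult_normal[OF D_in K c(1)])
  have "K <#> D <#> T \<subseteq> T <#> (K <#> D)"
  proof
    fix y assume "y \<in> K <#> D <#> T"
    then obtain k d t where y: "k \<in> K" "d \<in> D" "t \<in> T" "y = k \<otimes> d \<otimes> t" by (auto simp: mem_set_mult)
    have yc: "k \<in> carrier G" "d \<in> carrier G" "t \<in> carrier G"
      using y c subgroup.mem_carrier[OF subgroup_D] by auto
    have "proj (k \<otimes> t) \<in> proj ` (T <#> K)"
      using comm set_multI[OF y(1,3)] unfolding proj_set_mult[OF c, symmetric] proj_set_mult[OF c(2,1), symmetric]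
      by blast
    then obtain t' k' where tk: "t' \<in> T" "k' \<in> K" "proj (k \<otimes> t) = proj (t' \<otimes> k')"
      by (auto simp: mem_set_mult)
    have tkc: "t' \<in> carrier G" "k' \<in> carrier G" using tk c by auto
    have "k \<otimes> d \<otimes> t \<otimes> inv (k \<otimes> t) = k \<otimes> d \<otimes> inv k"
      using yc by (simp add: m_assoc inv_mult_group mult_inv_cancel)
    then have "proj y = proj (k \<otimes> t)"
      using proj_eq_iff[of y "k \<otimes> t"] normal_in_conj[OF D_in yc(1) y(2)] yc y(4) by (simp del: proj.hom_mult)
    then have "proj y = proj (t' \<otimes> k')" using tk(3) by (rule trans)
    then have d': "y \<otimes> inv (t' \<otimes> k') \<in> D"
      using proj_eq_iff[of y "t' \<otimes> k'"] yc tkc y(4) by (simp del: proj.hom_mult)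
    define e where "e = inv (t' \<otimes> k') \<otimes> (y \<otimes> inv (t' \<otimes> k')) \<otimes> inv (inv (t' \<otimes> k'))"
    have "e \<in> D" unfolding e_def using normal_in_conj[OF D_in _ d', of "inv (t' \<otimes> k')"] tkc by simp
    moreover have "y = t' \<otimes> (k' \<otimes> e)"
      unfolding e_def using tkc yc y(4) by (simp add: m_assoc inv_mult_group mult_inv_cancel)
    ultimately show "y \<in> T <#> (K <#> D)" using tk by (simp add: set_multI)
  qed
  then show ?thesis
    using set_mult_commute_if_subset[OF sKD T] subgroup_set_mult_iff[OF sKD T] by blast
qed

end

section \<open>Transitivity of sigma-permutability\<close>

text \<open>
  A Hall subgroup for a set \<open>\<tau>\<close> of blocks is a Hall subgroup for the set of primes \<open>\<Union>\<tau>\<close>.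
\<close>

lemma sigma_Hall_subgroup_block_union:
  assumes "prime_partition \<sigma>" "finite_group G" "sigma_Hall_subgroup \<sigma> G D"
  obtains \<pi> where "\<And>s. s \<in> \<sigma> \<Longrightarrow> s \<subseteq> \<pi> \<or> s \<inter> \<pi> = {}" "pi_number \<pi> (card D)"
    "pi_number (- \<pi>) (rel_index (carrier G) D)"
proof -
  interpret finite_group G by (rule assms(2))
  note disj = prime_partition_disjoint[OF assms(1)]
  obtain \<tau> where sD: "subgroup D G" and \<tau>: "\<tau> \<subseteq> \<sigma>"
    and num: "Sigma_number \<sigma> \<tau> (card D)" "Sigma_number \<sigma> (\<sigma> - \<tau>) (subgroup_index G D)"
    using assms(3) by (auto simp: sigma_Hall_subgroup_def)
  have block: "\<exists>s\<in>\<theta>. p \<in> s" if n: "Sigma_number \<sigma> \<theta> n" "p \<in> prime_factors n" for \<theta> n p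
  proof -
    obtain s where s: "s \<in> \<sigma>" "p \<in> s"
      using prime_partition_cover[OF assms(1) in_prime_factors_imp_prime[OF n(2)]] by blast
    then have "s \<in> sigma_of \<sigma> n" using n(2) by (auto simp: sigma_of_def)
    then show ?thesis using n(1) s(2) by (auto simp: Sigma_number_def)
  qed
  have blocks: "s \<subseteq> \<Union>\<tau> \<or> s \<inter> \<Union>\<tau> = {}" if "s \<in> \<sigma>" for s
    using disj[OF that] \<tau> by blast
  have "subgroup_index G D = rel_index (carrier G) D"
    using card_rcosets[OF sD subgroup_self] subgroup.subset[OF sD] by (simp add: subgroup_index_def)
  then have "p \<in> - \<Union>\<tau>" if "p \<in> prime_factors (rel_index (carrier G) D)" for p
    using block[OF num(2), of p] that disj \<tau> by fastforce
  then have "pi_number (- \<Union>\<tau>) (rel_index (carrier G) D)" unfolding pi_number_def by blast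
  moreover have "pi_number (\<Union>\<tau>) (card D)" using block[OF num(1)] by (auto simp: pi_number_def)
  ultimately show thesis using that[of "\<Union>\<tau>"] blocks by blast
qed

theorem theoremB:
  fixes \<sigma> :: "nat set set" and G :: "('a, 'b) monoid_scheme" and D :: "'a set"
  assumes "prime_partition \<sigma>"
    and "group G" and "finite (carrier G)"
    and "D \<lhd> G" and "sigma_Hall_subgroup \<sigma> G D"
    and "PsigmaT_group \<sigma> (G Mod D)"
    and "\<And>A. sigma_subnormal \<sigma> (G\<lparr>carrier := D\<rparr>) A \<Longrightarrow> A \<lhd> G"
    and "sigma_full_Sylow_type \<sigma> G"
  shows "PsigmaT_group \<sigma> G"
proof -
  interpret sigma_full_quotient G \<sigma> D
    using assms by (simp add: sigma_full_quotient_def sigma_full_quotient_axioms_def sigma_full_group_def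
      sigma_full_group_axioms_def finite_group_def finite_group_axioms_def)
  obtain \<pi> where \<pi>: "\<And>s. s \<in> \<sigma> \<Longrightarrow> s \<subseteq> \<pi> \<or> s \<inter> \<pi> = {}"
    and hallD: "pi_number \<pi> (card D)" "pi_number (- \<pi>) (rel_index (carrier G) D)"
    using sigma_Hall_subgroup_block_union[OF assms(1) finite_group_axioms assms(5)] by blast
  have "sigma_permutable \<sigma> G K"
    if KH: "sigma_permutable \<sigma> (G\<lparr>carrier := H\<rparr>) K" and H: "sigma_permutable \<sigma> G H" for H K
  proof -
    have sH: "subgroup H G" using H by (simp add: sigma_permutable_def)
    have pH: "permutable_in \<sigma> (carrier G) H"
      using permutable_in_if_sigma_permutable[of \<sigma> "carrier G" H] H subgroup_self by simp
    have pK: "permutable_in \<sigma> H K" by (rule permutable_in_if_sigma_permutable[OF KH sH])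
    have sK: "subgroup K G" using pK by (simp add: permutable_in_def)
    have chain: "(sigma_step \<sigma> G)\<^sup>*\<^sup>* K (carrier G)"
      using permutable_in_imp_sigma_chain[OF pK] permutable_in_imp_sigma_chain[OF pH] by (rule rtranclp_trans)
    then have "(sigma_step \<sigma> G)\<^sup>*\<^sup>* (K \<inter> D) (carrier G \<inter> D)"
      by (rule sigma_chain_Int[OF finite_group_axioms _ subgroup_D])
    moreover have "carrier G \<inter> D = D" using subgroup.subset[OF subgroup_D] by blast
    ultimately have "K \<inter> D \<lhd> G"
      using sigma_chain_imp_subnormal[OF _ subgroup_D] assms(7) by simp
    then have KD: "normal_in (K \<inter> D) (carrier G)" using normal_in_carrier_iff by blast
    \<comment> \<open>Hypothesis (i) applies to the images of \<open>K\<close> and \<open>H\<close>.\<close>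
    have "sigma_permutable \<sigma> (G Mod D) (proj ` H)"
      using sigma_permutable_proj[OF pH] by (simp add: carrier_FactGroup[symmetric])
    then have "sigma_permutable \<sigma> (G Mod D) (proj ` K)"
      using sigma_permutable_proj[OF pK] assms(6) unfolding PsigmaT_group_def by blast
    have "K <#>\<^bsub>G\<^esub> T = T <#>\<^bsub>G\<^esub> K" if s: "s \<in> \<sigma>" and T: "hall_in s (carrier G) T" for s T
    proof -
      have sT: "subgroup T G" "pi_number s (card T)" using T by (auto simp: hall_in_def)
      have "Q.hall_in s (carrier (G Mod D)) (proj ` T)"
        using hall_in_proj[OF subgroup_self T] by (simp add: carrier_FactGroup)
      then have "hall_subgroup s (G Mod D) (proj ` T)"
        using Q.hall_in_iff[OF Q.subgroup_self] by simp
      then have "subgroup ((K <#>\<^bsub>G\<^esub> D) <#>\<^bsub>G\<^esub> T) G"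
        using \<open>sigma_permutable \<sigma> (G Mod D) (proj ` K)\<close> s sK sT(1)
        by (intro subgroup_set_mult_if_proj_commute) (auto simp: sigma_permutable_def)
      then show ?thesis
        using commute_if_commute_modulo_normal_hall[OF D_in hallD _ sK chain KD s sT] \<pi> by blast
    qed
    then show ?thesis
      using H sK hall_in_iff[OF subgroup_self] by (auto simp: sigma_permutable_def)
  qed
  then show ?thesis by (auto simp: PsigmaT_group_def)
qed

end
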